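(* Let $L>0$ and let $(X,W)$ be a zero-mean bivariate Gaussian random field on $[0,L]$ with matrix covariance function $K=(K_{k\ell})_{1\le k,\ell\le2}$ such that each $K_{k\ell}$ belongs to the class $\mathcal K_{\alpha_{k\ell}}$ (defined in the context) with exponent parameter $\alpha_{k\ell}$, and let $Y=X\beta+W$. If the function $\Gamma_{\alpha_{11}}$ in the expansion of $K_{11}$ satisfies $\int_0^L\Gamma_{\alpha_{11}}(s,s)\,ds\ne0$ and $$\alpha_{11}<\min\{\alpha_{12},\ \alpha_{22}+1,\ 2\},$$ then the OLS estimator regressing first differences of $Y$ on those of $X$ on the regularly spaced grid in $[0,L]$, $$\frac{\sum_{i=1}^n\{X(ih)-X((i-1)h)\}\{Y(ih)-Y((i-1)h)\}}{\sum_{i=1}^n\{X(ih)-X((i-1)h)\}^2},\qquad h=L/n,$$ is consistent for $\beta$ (converges to $\beta$ in probability as $n\to\infty$).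
   Context: Class $\mathcal K_\alpha$ ($\alpha>0$): (cross-)covariance functions $K_\alpha$ on $[0,L]^2$ (not necessarily stationary) admitting the expansion $$K_\alpha(s,s')=\Gamma_0(s,s')+\Gamma_2(s,s')(s-s')^2+\Gamma_\alpha(s,s')\,|s-s'|^\alpha+r(s,s'),$$ where $\Gamma_0,\Gamma_2,\Gamma_\alpha$ are real analytic functions on $[0,L]^2$ and the remainder satisfies $r(s,s')\asymp\rho(|s-s'|)$ for some function $\rho$ with $\rho(t)=o(t^{\alpha'})$ and $\rho^{(k)}(t)=o(t^{\alpha'-k})$ as $t\to0$, $k=1,2,\dots$, with $\alpha'=\min(\alpha,2)$. Here $a\asymp b$ means $|a/b|$ is bounded above and bounded away from zero. The $\Gamma$'s, $r$, and $\rho$ may differ for each $(k,\ell)$. Index $1$ refers to $X$, $2$ to $W$.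
   Formalization: The derivative bounds on ρ are also required of the remainder r: all its partial derivatives of order k must be o(|s-s'|^{α'-k}) as |s-s'|→0; with r ≍ ρ(|s-s'|) as a bound on values only, the claim is false. *)

theory Defs
  imports "HOL-Probability.Probability" "HOL-Library.Landau_Symbols"
begin

text \<open>
  Real analyticity of a function of two variables on a set that need not be open: around every
  point of \<open>S\<close> there is a power series that converges to \<open>f\<close> on the nearby points of \<open>S\<close>. On a
  square this is the same as being the restriction of an analytic function on an open neighbourhood.
\<close>
definition real_analytic2_on :: "(real \<Rightarrow> real \<Rightarrow> real) \<Rightarrow> (real \<times> real) set \<Rightarrow> bool" where
  "real_analytic2_on f S \<longleftrightarrow>
     (\<forall>(a, b) \<in> S. \<exists>e > 0. \<exists>c :: nat \<Rightarrow> nat \<Rightarrow> real. \<forall>(s, s') \<in> S.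
        \<bar>s - a\<bar> < e \<longrightarrow> \<bar>s' - b\<bar> < e \<longrightarrow>
        ((\<lambda>(j, l). c j l * (s - a) ^ j * (s' - b) ^ l) has_sum f s s') UNIV)"

text \<open>
  \<open>comparable_on S a b\<close>: \<open>\<bar>a / b\<bar>\<close> is bounded and bounded away from zero on \<open>S\<close>. Writing the bounds
  without a quotient makes \<open>a\<close> and \<open>b\<close> vanish at the same points instead of relying on \<open>x / 0 = 0\<close>.
\<close>
definition comparable_on :: "'b set \<Rightarrow> ('b \<Rightarrow> real) \<Rightarrow> ('b \<Rightarrow> real) \<Rightarrow> bool" where
  "comparable_on S a b \<longleftrightarrow>
     (\<exists>c > 0. \<exists>C > 0. \<forall>x \<in> S. c * \<bar>b x\<bar> \<le> \<bar>a x\<bar> \<and> \<bar>a x\<bar> \<le> C * \<bar>b x\<bar>)"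

text \<open>
  \<open>\<rho>\<^sup>(\<^sup>k\<^sup>)(t) = o(t\<^sup>p\<^sup>-\<^sup>k)\<close> as \<open>t \<down> 0\<close> for all \<open>k \<ge> 0\<close>. The filter \<open>at_right 0\<close> does not see \<open>t = 0\<close>, where
  \<open>\<rho>(t) = o(t\<^sup>p)\<close> means \<open>\<rho>(0) = 0\<close>; without that clause a nugget effect would be allowed.
\<close>
definition small_with_derivs :: "real \<Rightarrow> (real \<Rightarrow> real) \<Rightarrow> bool" where
  "small_with_derivs p \<rho> \<longleftrightarrow>
     \<rho> 0 = 0 \<and>
     (\<forall>k. (\<forall>\<^sub>F t in at_right 0. (deriv ^^ k) \<rho> differentiable at t) \<and>
          (deriv ^^ k) \<rho> \<in> o[at_right 0](\<lambda>t. t powr (p - real k)))"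

text \<open>The limit \<open>\<bar>s - s'\<bar> \<down> 0\<close>, uniformly over the off-diagonal part of the square.\<close>
definition near_diagonal :: "real \<Rightarrow> (real \<times> real) filter" where
  "near_diagonal L =
     inf (filtercomap (\<lambda>(s, s'). \<bar>s - s'\<bar>) (at_right 0)) (principal ({0..L} \<times> {0..L}))"

text \<open>
  The bounds on the derivatives of \<open>\<rho>\<close>, carried over to the partial derivatives
  \<open>R j l = \<partial>\<^sup>j\<^sup>+\<^sup>l r / \<partial>s\<^sup>j \<partial>s'\<^sup>l\<close> off the diagonal (one-sided on the boundary of the square).
\<close>
definition small_with_partial_derivs :: "real \<Rightarrow> real \<Rightarrow> (real \<Rightarrow> real \<Rightarrow> real) \<Rightarrow> bool" where
  "small_with_partial_derivs L p r \<longleftrightarrow>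
     (\<exists>R :: nat \<Rightarrow> nat \<Rightarrow> real \<Rightarrow> real \<Rightarrow> real. R 0 0 = r \<and>
        (\<forall>j l. (\<forall>\<^sub>F (s, s') in near_diagonal L.
                  ((\<lambda>u. R j l u s') has_real_derivative R (Suc j) l s s') (at s within {0..L}) \<and>
                  ((\<lambda>u. R j l s u) has_real_derivative R j (Suc l) s s') (at s' within {0..L})) \<and>
               (\<lambda>(s, s'). R j l s s') \<in>
                  o[near_diagonal L](\<lambda>(s, s'). \<bar>s - s'\<bar> powr (p - real (j + l)))))"

text \<open>
  Comparability of \<open>r\<close> and \<open>\<rho>(\<bar>s - s'\<bar>)\<close> by itself says nothing about the smoothness of \<open>r\<close>. The
  differentiability of \<open>\<rho>\<close> is meant to describe that of \<open>r\<close>: both obey the same order bounds,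
  derivatives included.
\<close>
definition remainder_term :: "real \<Rightarrow> real \<Rightarrow> (real \<Rightarrow> real \<Rightarrow> real) \<Rightarrow> bool" where
  "remainder_term L p r \<longleftrightarrow>
     (\<exists>\<rho>. comparable_on ({0..L} \<times> {0..L}) (\<lambda>(s, s'). r s s') (\<lambda>(s, s'). \<rho> \<bar>s - s'\<bar>) \<and>
          small_with_derivs p \<rho>) \<and>
     small_with_partial_derivs L p r"

definition has_expansion ::
  "real \<Rightarrow> real \<Rightarrow> (real \<Rightarrow> real \<Rightarrow> real) \<Rightarrow> (real \<Rightarrow> real \<Rightarrow> real) \<Rightarrow> (real \<Rightarrow> real \<Rightarrow> real) \<Rightarrow>
   (real \<Rightarrow> real \<Rightarrow> real) \<Rightarrow> (real \<Rightarrow> real \<Rightarrow> real) \<Rightarrow> bool" where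
  "has_expansion L \<alpha> K \<Gamma>\<^sub>0 \<Gamma>\<^sub>2 \<Gamma>\<^sub>\<alpha> r \<longleftrightarrow>
     0 < \<alpha> \<and>
     real_analytic2_on \<Gamma>\<^sub>0 ({0..L} \<times> {0..L}) \<and>
     real_analytic2_on \<Gamma>\<^sub>2 ({0..L} \<times> {0..L}) \<and>
     real_analytic2_on \<Gamma>\<^sub>\<alpha> ({0..L} \<times> {0..L}) \<and>
     remainder_term L (min \<alpha> 2) r \<and>
     (\<forall>s \<in> {0..L}. \<forall>s' \<in> {0..L}.
        K s s' = \<Gamma>\<^sub>0 s s' + \<Gamma>\<^sub>2 s s' * (s - s')\<^sup>2 + \<Gamma>\<^sub>\<alpha> s s' * \<bar>s - s'\<bar> powr \<alpha> + r s s')"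

text \<open>
  The class \<open>\<K>\<^sub>\<alpha>\<close>. That its members are (cross-)covariance functions is not repeated here; below it
  is applied to the entries of the covariance function of a random field.
\<close>
definition in_class_K :: "real \<Rightarrow> real \<Rightarrow> (real \<Rightarrow> real \<Rightarrow> real) \<Rightarrow> bool" where
  "in_class_K L \<alpha> K \<longleftrightarrow> (\<exists>\<Gamma>\<^sub>0 \<Gamma>\<^sub>2 \<Gamma>\<^sub>\<alpha> r. has_expansion L \<alpha> K \<Gamma>\<^sub>0 \<Gamma>\<^sub>2 \<Gamma>\<^sub>\<alpha> r)"

text \<open>Gaussian random variables, degenerate ones included.\<close>
definition gaussian_rv :: "'a measure \<Rightarrow> ('a \<Rightarrow> real) \<Rightarrow> bool" where
  "gaussian_rv M Z \<longleftrightarrow>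
     Z \<in> borel_measurable M \<and>
     (\<exists>\<mu> \<sigma>. (\<sigma> = 0 \<and> (AE \<omega> in M. Z \<omega> = \<mu>)) \<or>
            (0 < \<sigma> \<and> distributed M lborel Z (normal_density \<mu> \<sigma>)))"

text \<open>
  A zero-mean Gaussian field on \<open>T\<close> with components indexed by \<open>I\<close> and matrix covariance function
  \<open>K\<close>: all finite linear combinations are Gaussian. As the means vanish, covariances are expectations of
  products.
\<close>
definition zero_mean_gaussian_field ::
  "'a measure \<Rightarrow> 'i set \<Rightarrow> 't set \<Rightarrow> ('i \<Rightarrow> 't \<Rightarrow> 'a \<Rightarrow> real) \<Rightarrow>
   ('i \<Rightarrow> 'i \<Rightarrow> 't \<Rightarrow> 't \<Rightarrow> real) \<Rightarrow> bool" where
  "zero_mean_gaussian_field M I T Z K \<longleftrightarrow>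
     prob_space M \<and>
     (\<forall>F c. finite F \<and> F \<subseteq> I \<times> T \<longrightarrow> gaussian_rv M (\<lambda>\<omega>. \<Sum>(k, s)\<in>F. c k s * Z k s \<omega>)) \<and>
     (\<forall>k\<in>I. \<forall>s\<in>T. integral\<^sup>L M (Z k s) = 0) \<and>
     (\<forall>k\<in>I. \<forall>l\<in>I. \<forall>s\<in>T. \<forall>s'\<in>T. integral\<^sup>L M (\<lambda>\<omega>. Z k s \<omega> * Z l s' \<omega>) = K k l s s')"

definition ols_first_differences :: "real \<Rightarrow> nat \<Rightarrow> (real \<Rightarrow> real) \<Rightarrow> (real \<Rightarrow> real) \<Rightarrow> real" where
  "ols_first_differences L n x y =
     (let h = L / real n in
      (\<Sum>i=1..n. (x (real i * h) - x ((real i - 1) * h)) * (y (real i * h) - y ((real i - 1) * h)))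
      / (\<Sum>i=1..n. (x (real i * h) - x ((real i - 1) * h))\<^sup>2))"

definition converges_in_probability ::
  "'a measure \<Rightarrow> (nat \<Rightarrow> 'a \<Rightarrow> real) \<Rightarrow> real \<Rightarrow> bool" where
  "converges_in_probability M T \<theta> \<longleftrightarrow>
     (\<forall>\<epsilon>>0. (\<lambda>n. measure M {\<omega> \<in> space M. \<bar>T n \<omega> - \<theta>\<bar> > \<epsilon>}) \<longlonglongrightarrow> 0)"

end

theory Submission
  imports Defs "HOL-Real_Asymp.Real_Asymp"
begin

text \<open>
  Write \<open>S\<close> and \<open>N\<close> for the sums of \<open>\<Delta>X\<^sub>i\<^sup>2\<close> and \<open>\<Delta>X\<^sub>i \<Delta>W\<^sub>i\<close>; the estimation error is \<open>N / S\<close>. With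
  \<open>a = \<alpha>\<^sub>1\<^sub>1\<close>, the mean of \<open>S\<close> divided by \<open>h\<^sup>a\<^sup>-\<^sup>1\<close> tends to \<open>- 2 \<integral> \<Gamma>\<^sub>\<alpha>(s, s) ds\<close>, which is nonnegative as a limit
  of second moments and nonzero by hypothesis, whereas the mean of \<open>N\<close> is of smaller order. By
  Chebyshev it remains to show that both variances are \<open>o(h\<^sup>2\<^sup>a\<^sup>-\<^sup>2)\<close>.

  By the formula of Isserlis the variances are sums of products of two mixed second differences of the
  covariance functions. For a member of the class with exponent \<open>\<alpha>\<close>, such a difference over cells at distance
  \<open>k h\<close> is at most a multiple of \<open>h\<^sup>p k\<^sup>p\<^sup>-\<^sup>2\<close>, for every \<open>p \<le> min \<alpha> 2\<close>. The freedom to lower \<open>p\<close> lets one choose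
  exponents with sum \<open>q\<close> strictly between \<open>2 a - 1\<close> and \<open>3\<close>, so that the sum over \<open>k\<close> converges and the
  variance is \<open>O(h\<^sup>q\<^sup>-\<^sup>1)\<close>.

  These bounds hold only near the diagonal, because the remainder \<open>r\<close> need not be smooth elsewhere. Splitting
  the increments into a fixed number \<open>m\<close> of short blocks and estimating the square of a sum of \<open>m\<close> terms by \<open>m\<close>
  times the sum of their squares removes all covariances between distant increments.
\<close>

section \<open>Analytic functions near the diagonal\<close>

lemma has_sum_abs_le:
  fixes f g :: "'b \<Rightarrow> real"
  assumes "(f has_sum a) S" "(g has_sum b) S" "\<And>x. x \<in> S \<Longrightarrow> \<bar>f x\<bar> \<le> g x"
  shows "\<bar>a\<bar> \<le> b"
proof -
  have "a \<le> b"
    by (rule has_sum_mono[OF assms(1,2)]) (use assms(3) in fastforce)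
  moreover have "-b \<le> a"
    by (rule has_sum_mono[OF _ assms(1), of "\<lambda>x. - g x"])
       (use assms(2,3) in \<open>force simp: has_sum_uminus abs_le_iff\<close>)+
  ultimately show ?thesis by linarith
qed

lemma has_sum_diff:
  fixes f g :: "'b \<Rightarrow> real"
  assumes "(f has_sum a) S" "(g has_sum b) S"
  shows "((\<lambda>x. f x - g x) has_sum (a - b)) S"
  using has_sum_add[OF assms(1), of "\<lambda>x. - g x" "- b"] assms(2) by (simp add: has_sum_uminus)

text \<open>Factoring out \<open>x - y\<close> leaves \<open>j\<close> terms of size
  \<open>(d / 2) ^ (j - 1)\<close>. Halving the radius pays for their number because
  \<open>j \<le> 2 ^ j\<close>, so the bound depends on \<open>j\<close> just as
  \<open>d ^ j\<close> does and can be summed against the series at radius \<open>d\<close>.\<close>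

lemma power_diff_le_double_radius:
  fixes x y d :: real
  assumes "\<bar>x\<bar> \<le> d / 2" "\<bar>y\<bar> \<le> d / 2" "0 < d"
  shows "\<bar>x ^ j - y ^ j\<bar> \<le> 2 / d * d ^ j * \<bar>x - y\<bar>"
proof (cases j)
  case 0
  then show ?thesis using assms(3) by simp
next
  case (Suc m)
  have "\<bar>x ^ j - y ^ j\<bar> = \<bar>x - y\<bar> * \<bar>\<Sum>p<Suc m. x ^ p * y ^ (m - p)\<bar>"
    unfolding Suc power_diff_sumr2[of x "Suc m" y] by (simp add: abs_mult mult.commute)
  also have "\<dots> \<le> \<bar>x - y\<bar> * (2 / d * d ^ j)"
  proof (rule mult_left_mono)
    have "\<bar>\<Sum>p<Suc m. x ^ p * y ^ (m - p)\<bar> \<le> (\<Sum>p<Suc m. (d / 2) ^ m)"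
    proof (rule order_trans[OF sum_abs], rule sum_mono)
      fix p assume "p \<in> {..<Suc m}"
      then have "(d / 2) ^ m = (d / 2) ^ p * (d / 2) ^ (m - p)"
        by (simp flip: power_add)
      then show "\<bar>x ^ p * y ^ (m - p)\<bar> \<le> (d / 2) ^ m"
        using assms by (auto simp: abs_mult power_abs intro!: mult_mono power_mono)
    qed
    also have "(\<Sum>p<Suc m. (d / 2) ^ m) = real (Suc m) / 2 ^ m * d ^ m"
      by (simp add: power_divide)
    also have "real (Suc m) / 2 ^ m * d ^ m \<le> 2 * d ^ m"
    proof -
      have "Suc m \<le> 2 ^ Suc m" using less_exp[of "Suc m"] by linarith
      then have "real (Suc m) \<le> real (2 ^ Suc m)" by (rule of_nat_mono)
      then show ?thesis using assms(3) by (intro mult_right_mono) (auto simp: field_simps)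
    qed
    also have "2 * d ^ m = 2 / d * d ^ j" using assms(3) Suc by simp
    finally show "\<bar>\<Sum>p<Suc m. x ^ p * y ^ (m - p)\<bar> \<le> 2 / d * d ^ j" .
  qed simp
  finally show ?thesis by (simp only: mult.commute)
qed

text \<open>If \<open>f\<close> is a cross-covariance function, this is the covariance of an
  increment of the first process over \<open>s\<close>, \<open>s'\<close> and one of the second over
  \<open>t\<close>, \<open>t'\<close>.\<close>

definition rect_increment :: "(real \<Rightarrow> real \<Rightarrow> real) \<Rightarrow> real \<Rightarrow> real \<Rightarrow> real \<Rightarrow> real \<Rightarrow> real" where
  "rect_increment f s s' t t' = f s' t' - f s' t - f s t' + f s t"

text \<open>A derivative-free substitute for bounded first and mixed second derivatives. Both
  arguments range over the same set, so for a short interval \<open>B\<close> only points near the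
  diagonal are concerned.\<close>

definition bi_lipschitz_on :: "real set \<Rightarrow> real \<Rightarrow> (real \<Rightarrow> real \<Rightarrow> real) \<Rightarrow> bool" where
  "bi_lipschitz_on B C f \<longleftrightarrow> 0 \<le> C \<and> (\<forall>s\<in>B. \<forall>s'\<in>B. \<forall>t\<in>B. \<forall>t'\<in>B.
     \<bar>f s t\<bar> \<le> C \<and> \<bar>f s t - f s' t\<bar> \<le> C * \<bar>s' - s\<bar> \<and> \<bar>f s t - f s t'\<bar> \<le> C * \<bar>t' - t\<bar> \<and>
     \<bar>rect_increment f s s' t t'\<bar> \<le> C * \<bar>s' - s\<bar> * \<bar>t' - t\<bar>)"

lemma bi_lipschitz_onD:
  assumes "bi_lipschitz_on B C f" "s \<in> B" "s' \<in> B" "t \<in> B" "t' \<in> B"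
  shows "\<bar>f s t\<bar> \<le> C" "\<bar>f s t - f s' t\<bar> \<le> C * \<bar>s' - s\<bar>" "\<bar>f s t - f s t'\<bar> \<le> C * \<bar>t' - t\<bar>"
    "\<bar>rect_increment f s s' t t'\<bar> \<le> C * \<bar>s' - s\<bar> * \<bar>t' - t\<bar>"
  using assms unfolding bi_lipschitz_on_def by blast+

lemma bi_lipschitz_on_mono:
  assumes "bi_lipschitz_on B C f" "B' \<subseteq> B" "C \<le> C'"
  shows "bi_lipschitz_on B' C' f"
proof -
  have *: "C * u \<le> C' * u" if "0 \<le> u" for u using that assms(3) by (rule mult_right_mono[rotated])
  have **: "C * u * v \<le> C' * u * v" if "0 \<le> u" "0 \<le> v" for u v 
    using that assms(3) by (intro mult_right_mono) auto
  show ?thesis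
    unfolding bi_lipschitz_on_def
  proof (intro conjI ballI)
    show "0 \<le> C'" using assms by (auto simp: bi_lipschitz_on_def)
    fix s s' t t' assume "s \<in> B'" "s' \<in> B'" "t \<in> B'" "t' \<in> B'"
    then have "s \<in> B" "s' \<in> B" "t \<in> B" "t' \<in> B" using assms(2) by auto
    then have "\<bar>f s t\<bar> \<le> C" "\<bar>f s t - f s' t\<bar> \<le> C * \<bar>s' - s\<bar>" "\<bar>f s t - f s t'\<bar> \<le> C * \<bar>t' - t\<bar>"
        "\<bar>rect_increment f s s' t t'\<bar> \<le> C * \<bar>s' - s\<bar> * \<bar>t' - t\<bar>"
      using bi_lipschitz_onD[OF assms(1), of s s' t t'] by simp_all
    then show "\<bar>f s t\<bar> \<le> C'" "\<bar>f s t - f s' t\<bar> \<le> C' * \<bar>s' - s\<bar>" "\<bar>f s t - f s t'\<bar> \<le> C' * \<bar>t' - t\<bar>"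
        "\<bar>rect_increment f s s' t t'\<bar> \<le> C' * \<bar>s' - s\<bar> * \<bar>t' - t\<bar>"
      using assms(3) by (auto intro: order_trans[OF _ *] order_trans[OF _ **])
  qed
qed

text \<open>
  The series converges absolutely at a reference point at distance \<open>d\<close> from \<open>a\<close> in both coordinates, which
  exists inside the square even when \<open>a\<close> is an endpoint. Within distance \<open>d / 2\<close>, each increment of a power costs
  only a constant factor over the term at the reference point.
\<close>
lemma real_analytic2_on_bi_lipschitz_local:
  assumes "real_analytic2_on f ({0..L} \<times> {0..L})" "0 < L" "a \<in> {0..L}"
  shows "\<exists>e>0. \<exists>C. bi_lipschitz_on ({0..L} \<inter> ball a e) C f"
proof -
  obtain e c where e: "0 < e" and c: "\<And>s t. s \<in> {0..L} \<Longrightarrow> t \<in> {0..L} \<Longrightarrow> \<bar>s - a\<bar> < e \<Longrightarrow> \<bar>t - a\<bar> < e \<Longrightarrow>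
      ((\<lambda>(j, l). c j l * (s - a) ^ j * (t - a) ^ l) has_sum f s t) UNIV"
  proof -
    have "(a, a) \<in> {0..L} \<times> {0..L}" using assms(3) by simp
    note bspec[OF assms(1)[unfolded real_analytic2_on_def] this, unfolded prod.case]
    then obtain e c where "0 < e" and "\<forall>(s, t) \<in> {0..L} \<times> {0..L}. \<bar>s - a\<bar> < e \<longrightarrow> \<bar>t - a\<bar> < e \<longrightarrow>
      ((\<lambda>(j, l). c j l * (s - a) ^ j * (t - a) ^ l) has_sum f s t) UNIV" by (elim exE conjE)
    then show ?thesis by (intro that[of e c]) auto
  qed
  \<comment> \<open>\<open>e / 2\<close> keeps the reference point where the expansion is valid, and
    \<open>L / 2\<close> ensures that \<open>a + d\<close> or \<open>a - d\<close> stays in the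
    interval.\<close>
  define d where "d = min (e / 2) (L / 2)"
  have d: "0 < d" "d < e" "d \<le> L / 2" using e assms(2) by (auto simp: d_def)
  obtain u where u: "u \<in> {0..L}" "\<bar>u - a\<bar> = d"
  proof (cases "a \<le> L / 2")
    case True
    with d assms(3) show ?thesis by (intro that[of "a + d"]) auto
  next
    case False
    with d assms(3) show ?thesis by (intro that[of "a - d"]) auto
  qed
  have "(\<lambda>(j, l). c j l * (u - a) ^ j * (u - a) ^ l) summable_on UNIV"
    using c[of u u] u d by (auto simp: summable_on_def)
  \<comment> \<open>Unordered summability of reals is absolute, so the absolute values at the
    reference point form a convergent majorant.\<close>
  then have "(\<lambda>x. norm ((\<lambda>(j, l). c j l * (u - a) ^ j * (u - a) ^ l) x)) summable_on UNIV"
    using summable_on_iff_abs_summable_on_real by blast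
  moreover have "(\<lambda>x. norm ((\<lambda>(j, l). c j l * (u - a) ^ j * (u - a) ^ l) x)) =
      (\<lambda>(j, l). \<bar>c j l\<bar> * d ^ j * d ^ l)"
    using u by (auto simp: fun_eq_iff abs_mult power_abs)
  ultimately obtain A where A: "((\<lambda>(j, l). \<bar>c j l\<bar> * d ^ j * d ^ l) has_sum A) UNIV"
    by (auto simp: summable_on_def)
  have "0 \<le> A"
    by (rule has_sum_nonneg[OF A]) (use d in auto)
  define B where "B = {0..L} \<inter> ball a (d / 2)"
  \<comment> \<open>The summands serve the values, the increments in one variable and the
    rectangular increments: every increment taken costs a factor \<open>2 / d\<close>.\<close>
  define C where "C = A * (1 + 2 / d + 2 / d * (2 / d))"
  have B: "\<bar>s - a\<bar> \<le> d / 2" "s \<in> {0..L}" "\<bar>s - a\<bar> < e" "\<bar>s - a\<bar> \<le> d" if "s \<in> B" for s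
    using that d by (auto simp: B_def dist_real_def abs_minus_commute[of a])
  have AC: "A \<le> C" "A * (2 / d) \<le> C" "A * (2 / d) * (2 / d) \<le> C"
    using \<open>0 \<le> A\<close> d by (auto simp: C_def distrib_left algebra_simps)
  have pw: "\<bar>(s - a) ^ j\<bar> \<le> d ^ j" if "s \<in> B" for s j
    using B[OF that] by (auto simp: power_abs intro!: power_mono)
  have pd: "\<bar>(s' - a) ^ j - (s - a) ^ j\<bar> \<le> 2 / d * d ^ j * \<bar>s' - s\<bar>" if "s \<in> B" "s' \<in> B" for s s' j
    using power_diff_le_double_radius[of "s' - a" d "s - a"] B[OF that(1)] B[OF that(2)] d by simp
  note c' = c[OF B(2) B(2) B(3) B(3)]
  have "bi_lipschitz_on B C f"
    unfolding bi_lipschitz_on_def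
  proof (intro conjI ballI)
    show "0 \<le> C" using AC \<open>0 \<le> A\<close> by linarith
    fix s s' t t' assume m: "s \<in> B" "s' \<in> B" "t \<in> B" "t' \<in> B"
    have "\<bar>f s t\<bar> \<le> A"
      by (rule has_sum_abs_le[OF c' A])
         (use m d pw in \<open>auto simp: abs_mult intro!: mult_mono\<close>)
    then show "\<bar>f s t\<bar> \<le> C" using AC by linarith
    have "\<bar>f s t - f s' t\<bar> \<le> A * (2 / d * \<bar>s' - s\<bar>)"
    proof (rule has_sum_abs_le[OF has_sum_diff[OF c' c'] has_sum_cmult_left[OF A]])
      fix x :: "nat \<times> nat"
      obtain j l where x: "x = (j, l)" by force
      have "\<bar>c j l * (s - a) ^ j * (t - a) ^ l - c j l * (s' - a) ^ j * (t - a) ^ l\<bar>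
          = \<bar>c j l * ((s' - a) ^ j - (s - a) ^ j) * (t - a) ^ l\<bar>"
        by (subst abs_minus_commute) (simp only: left_diff_distrib right_diff_distrib)
      also have "\<dots> \<le> \<bar>c j l\<bar> * (2 / d * d ^ j * \<bar>s' - s\<bar>) * d ^ l"
        using m pd pw d unfolding abs_mult by (intro mult_mono) auto
      finally show "\<bar>(case x of (j, l) \<Rightarrow> c j l * (s - a) ^ j * (t - a) ^ l) -
              (case x of (j, l) \<Rightarrow> c j l * (s' - a) ^ j * (t - a) ^ l)\<bar>
           \<le> (case x of (j, l) \<Rightarrow> \<bar>c j l\<bar> * d ^ j * d ^ l) * (2 / d * \<bar>s' - s\<bar>)"
        by (simp add: x algebra_simps)
    qed (use m in auto)
    also have "\<dots> \<le> C * \<bar>s' - s\<bar>"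
      using mult_right_mono[OF AC(2), of "\<bar>s' - s\<bar>"] by (simp only: mult.assoc abs_ge_zero)
    finally show "\<bar>f s t - f s' t\<bar> \<le> C * \<bar>s' - s\<bar>" .
    have "\<bar>f s t - f s t'\<bar> \<le> A * (2 / d * \<bar>t' - t\<bar>)"
    proof (rule has_sum_abs_le[OF has_sum_diff[OF c' c'] has_sum_cmult_left[OF A]])
      fix x :: "nat \<times> nat"
      obtain j l where x: "x = (j, l)" by force
      have "\<bar>c j l * (s - a) ^ j * (t - a) ^ l - c j l * (s - a) ^ j * (t' - a) ^ l\<bar>
          = \<bar>c j l * (s - a) ^ j * ((t' - a) ^ l - (t - a) ^ l)\<bar>"
        by (subst abs_minus_commute) (simp only: left_diff_distrib right_diff_distrib)
      also have "\<dots> \<le> \<bar>c j l\<bar> * d ^ j * (2 / d * d ^ l * \<bar>t' - t\<bar>)"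
        using m pd pw d unfolding abs_mult by (intro mult_mono) auto
      finally show "\<bar>(case x of (j, l) \<Rightarrow> c j l * (s - a) ^ j * (t - a) ^ l) -
              (case x of (j, l) \<Rightarrow> c j l * (s - a) ^ j * (t' - a) ^ l)\<bar>
           \<le> (case x of (j, l) \<Rightarrow> \<bar>c j l\<bar> * d ^ j * d ^ l) * (2 / d * \<bar>t' - t\<bar>)"
        by (simp add: x algebra_simps)
    qed (use m in auto)
    also have "\<dots> \<le> C * \<bar>t' - t\<bar>"
      using mult_right_mono[OF AC(2), of "\<bar>t' - t\<bar>"] by (simp only: mult.assoc abs_ge_zero)
    finally show "\<bar>f s t - f s t'\<bar> \<le> C * \<bar>t' - t\<bar>" .
    have "\<bar>rect_increment f s s' t t'\<bar> \<le> A * (2 / d * \<bar>s' - s\<bar> * (2 / d * \<bar>t' - t\<bar>))"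
      unfolding rect_increment_def
    proof (rule has_sum_abs_le[OF has_sum_add[OF has_sum_diff[OF has_sum_diff[OF c' c'] c'] c'] has_sum_cmult_left[OF A]])
      fix x :: "nat \<times> nat"
      obtain j l where x: "x = (j, l)" by force
      have "\<bar>c j l * (s' - a) ^ j * (t' - a) ^ l - c j l * (s' - a) ^ j * (t - a) ^ l
           - c j l * (s - a) ^ j * (t' - a) ^ l + c j l * (s - a) ^ j * (t - a) ^ l\<bar>
          = \<bar>c j l * ((s' - a) ^ j - (s - a) ^ j) * ((t' - a) ^ l - (t - a) ^ l)\<bar>"
        by (simp add: algebra_simps)
      also have "\<dots> \<le> \<bar>c j l\<bar> * (2 / d * d ^ j * \<bar>s' - s\<bar>) * (2 / d * d ^ l * \<bar>t' - t\<bar>)"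
        using m pd d unfolding abs_mult by (intro mult_mono) auto
      finally show "\<bar>(case x of (j, l) \<Rightarrow> c j l * (s' - a) ^ j * (t' - a) ^ l) -
              (case x of (j, l) \<Rightarrow> c j l * (s' - a) ^ j * (t - a) ^ l) -
              (case x of (j, l) \<Rightarrow> c j l * (s - a) ^ j * (t' - a) ^ l) +
              (case x of (j, l) \<Rightarrow> c j l * (s - a) ^ j * (t - a) ^ l)\<bar>
           \<le> (case x of (j, l) \<Rightarrow> \<bar>c j l\<bar> * d ^ j * d ^ l) * (2 / d * \<bar>s' - s\<bar> * (2 / d * \<bar>t' - t\<bar>))"
        by (simp add: x algebra_simps)
    qed (use m in auto)
    also have "\<dots> = A * (2 / d) * (2 / d) * (\<bar>s' - s\<bar> * \<bar>t' - t\<bar>)" by simp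
    also have "\<dots> \<le> C * (\<bar>s' - s\<bar> * \<bar>t' - t\<bar>)" using AC(3) by (intro mult_right_mono) auto
    finally show "\<bar>rect_increment f s s' t t'\<bar> \<le> C * \<bar>s' - s\<bar> * \<bar>t' - t\<bar>" by (simp add: mult.assoc)
  qed
  then show ?thesis using d by (intro exI[of _ "d / 2"]) (auto simp: B_def)
qed

text \<open>Compactness makes the local constants uniform. Since the balls of half radius already
  cover the interval, a ball of radius \<open>\<delta>\<close> around any point fits into one of the
  full balls, as for a Lebesgue number; the sum of the finitely many nonnegative constants dominates
  each of them.\<close>

lemma real_analytic2_on_bi_lipschitz:
  assumes "real_analytic2_on f ({0..L} \<times> {0..L})" "0 < L"
  obtains C \<delta> where "0 < \<delta>" "\<And>a. a \<in> {0..L} \<Longrightarrow> bi_lipschitz_on ({0..L} \<inter> ball a \<delta>) C f"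
proof -
  have "\<forall>a\<in>{0..L}. \<exists>e. 0 < e \<and> (\<exists>C. bi_lipschitz_on ({0..L} \<inter> ball a e) C f)"
    using real_analytic2_on_bi_lipschitz_local[OF assms] by blast
  then obtain e C where e: "\<And>a. a \<in> {0..L} \<Longrightarrow> 0 < e a" 
      and C: "\<And>a. a \<in> {0..L} \<Longrightarrow> bi_lipschitz_on ({0..L} \<inter> ball a (e a)) (C a) f"
    by metis
  obtain D where D: "D \<subseteq> {0..L}" "finite D" "{0..L} \<subseteq> (\<Union>a\<in>D. ball a (e a / 2))"
  proof (rule compactE_image[of "{0..L}" "{0..L}" "\<lambda>a. ball a (e a / 2)"])
    show "{0..L} \<subseteq> (\<Union>a\<in>{0..L}. ball a (e a / 2))"
    proof
      fix a assume "a \<in> {0..L}"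
      then show "a \<in> (\<Union>a\<in>{0..L}. ball a (e a / 2))" using e(1)[of a] by (intro UN_I[of a]) auto
    qed
  qed auto
  have "D \<noteq> {}" using D(3) assms(2) by fastforce
  define \<delta> where "\<delta> = Min ((\<lambda>a. e a / 2) ` D)"
  have C0: "0 \<le> C a" if "a \<in> D" for a
    using C D(1) that by (auto simp: bi_lipschitz_on_def)
  show ?thesis
  proof
    show "0 < \<delta>" using D \<open>D \<noteq> {}\<close> e(1) by (auto simp: \<delta>_def)
    fix x assume "x \<in> {0..L}"
    then obtain a where a: "a \<in> D" "dist a x < e a / 2" using D by auto
    have "\<delta> \<le> e a / 2" unfolding \<delta>_def using a(1) D(2) by (intro Min_le) auto
    then have "{0..L} \<inter> ball x \<delta> \<subseteq> {0..L} \<inter> ball a (e a)"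
      using a by (auto simp: dist_real_def abs_if split: if_splits)
    moreover have "C a \<le> sum C D" using C0 a D by (intro member_le_sum) auto
    ultimately show "bi_lipschitz_on ({0..L} \<inter> ball x \<delta>) (sum C D) f"
      using C[of a] a D by (blast intro: bi_lipschitz_on_mono)
  qed
qed

section \<open>Mixed second differences of covariance functions\<close>

text \<open>Only finitely many \<open>k\<close> escape the asymptotic bound. As \<open>g\<close> is
  positive everywhere, adding their ratios to the constant covers them too.\<close>

lemma bigo_nat_imp_bound:
  fixes f g :: "nat \<Rightarrow> real"
  assumes "f \<in> O(g)" "\<And>k. 0 < g k"
  obtains C where "0 \<le> C" "\<And>k. \<bar>f k\<bar> \<le> C * g k"
proof -
  obtain c N where c: "0 < c" "\<And>k. k \<ge> N \<Longrightarrow> \<bar>f k\<bar> \<le> c * g k"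
  proof -
    obtain c where c: "0 < c" "\<forall>\<^sub>F k in at_top. norm (f k) \<le> c * norm (g k)"
      using assms(1) by (rule landau_o.bigE)
    then obtain N where "\<And>k. k \<ge> N \<Longrightarrow> norm (f k) \<le> c * norm (g k)"
      by (auto simp: eventually_at_top_linorder)
    then show ?thesis using c(1) assms(2) by (intro that[of c N]) (auto simp: less_imp_le abs_of_pos)
  qed
  define C where "C = c + (\<Sum>k<N. \<bar>f k\<bar> / g k)"
  have nn: "0 \<le> (\<Sum>k<N. \<bar>f k\<bar> / g k)"
    using assms(2) by (intro sum_nonneg) (simp add: less_imp_le)
  show ?thesis
  proof
    show "0 \<le> C" using c nn by (simp add: C_def)
    fix k show "\<bar>f k\<bar> \<le> C * g k"
    proof (cases "k < N")
      case True
      then have "\<bar>f k\<bar> / g k \<le> (\<Sum>k<N. \<bar>f k\<bar> / g k)"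
        using assms(2) by (intro member_le_sum) (auto simp: less_imp_le)
      then have "\<bar>f k\<bar> / g k \<le> C" using c by (simp add: C_def)
      then show ?thesis using assms(2)[of k] by (simp add: field_simps)
    next
      case False
      then have "\<bar>f k\<bar> \<le> c * g k" using c by simp
      also have "\<dots> \<le> C * g k" using nn assms(2)[of k] by (intro mult_right_mono) (auto simp: C_def)
      finally show ?thesis .
    qed
  qed
qed

text \<open>
  The cells have side \<open>h\<close> and the integer \<open>k\<close> is their distance from the diagonal in units of \<open>h\<close>, as for pairs
  of increments along a regular mesh. The bound is the size \<open>h\<^sup>2 d\<^sup>p\<^sup>-\<^sup>2\<close> of \<open>h\<^sup>2\<close> times a mixed derivative at
  distance \<open>d = k h\<close>.
\<close>
definition cell_bounded :: "real \<Rightarrow> real \<Rightarrow> (real \<Rightarrow> real \<Rightarrow> real) \<Rightarrow> bool" where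
  "cell_bounded L p f \<longleftrightarrow> (\<exists>C \<delta>. 0 \<le> C \<and> 0 < \<delta> \<and>
     (\<forall>h s t k. 0 < h \<longrightarrow> h < \<delta> \<longrightarrow> real k * h < \<delta> \<longrightarrow> s \<in> {0..L - h} \<longrightarrow> t \<in> {0..L - h} \<longrightarrow>
        \<bar>s - t\<bar> = real k * h \<longrightarrow>
        \<bar>rect_increment f s (s + h) t (t + h)\<bar> \<le> C * (h powr p * max 1 (real k) powr (p - 2))))"

text \<open>Capping the threshold at 1 provides the extra facts \<open>h \<le> 1\<close> and
  \<open>max 1 (real k) * h \<le> 1\<close>, with which powers of different exponents are
  compared.\<close>

lemma cell_boundedI:
  assumes "0 \<le> C" "0 < \<delta>"
    "\<And>h s t k. 0 < h \<Longrightarrow> h < \<delta> \<Longrightarrow> h \<le> 1 \<Longrightarrow> real k * h < \<delta> \<Longrightarrow> real k * h \<le> 1 \<Longrightarrow> max 1 (real k) * h \<le> 1 \<Longrightarrow>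
       s \<in> {0..L} \<Longrightarrow> s + h \<in> {0..L} \<Longrightarrow> t \<in> {0..L} \<Longrightarrow> t + h \<in> {0..L} \<Longrightarrow> \<bar>s - t\<bar> = real k * h \<Longrightarrow>
       \<bar>rect_increment f s (s + h) t (t + h)\<bar> \<le> C * (h powr p * max 1 (real k) powr (p - 2))"
  shows "cell_bounded L p f"
  unfolding cell_bounded_def
  using assms(1,2) by (intro exI[of _ C] exI[of _ "min 1 \<delta>"] conjI allI impI assms(3)) (auto simp: max_def)

lemma cell_boundedE:
  assumes "cell_bounded L p f"
  obtains C \<delta> where "0 \<le> C" "0 < \<delta>"
    "\<And>h s t k. 0 < h \<Longrightarrow> h < \<delta> \<Longrightarrow> real k * h < \<delta> \<Longrightarrow> s \<in> {0..L} \<Longrightarrow> s + h \<in> {0..L} \<Longrightarrow> t \<in> {0..L} \<Longrightarrow> t + h \<in> {0..L} \<Longrightarrow>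
      \<bar>s - t\<bar> = real k * h \<Longrightarrow>
      \<bar>rect_increment f s (s + h) t (t + h)\<bar> \<le> C * (h powr p * max 1 (real k) powr (p - 2))"
proof -
  obtain C \<delta> where *: "0 \<le> C" "0 < \<delta>" "\<forall>h s t k. 0 < h \<longrightarrow> h < \<delta> \<longrightarrow> real k * h < \<delta> \<longrightarrow> s \<in> {0..L - h} \<longrightarrow> t \<in> {0..L - h} \<longrightarrow>
        \<bar>s - t\<bar> = real k * h \<longrightarrow>
        \<bar>rect_increment f s (s + h) t (t + h)\<bar> \<le> C * (h powr p * max 1 (real k) powr (p - 2))"
    using assms unfolding cell_bounded_def by blast
  show ?thesis
    by (rule that[OF *(1,2)], rule *(3)[rule_format]) auto
qed

lemma cell_bounded_add:
  assumes "cell_bounded L p f" "cell_bounded L p g"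
  shows "cell_bounded L p (\<lambda>s t. f s t + g s t)"
proof -
  obtain C \<delta> where f: "0 \<le> C" "0 < \<delta>"
    "\<And>h s t k. 0 < h \<Longrightarrow> h < \<delta> \<Longrightarrow> real k * h < \<delta> \<Longrightarrow> s \<in> {0..L} \<Longrightarrow> s + h \<in> {0..L} \<Longrightarrow> t \<in> {0..L} \<Longrightarrow> t + h \<in> {0..L} \<Longrightarrow>
      \<bar>s - t\<bar> = real k * h \<Longrightarrow>
      \<bar>rect_increment f s (s + h) t (t + h)\<bar> \<le> C * (h powr p * max 1 (real k) powr (p - 2))"
    using cell_boundedE[OF assms(1)] by metis
  obtain C' \<delta>' where g: "0 \<le> C'" "0 < \<delta>'"
    "\<And>h s t k. 0 < h \<Longrightarrow> h < \<delta>' \<Longrightarrow> real k * h < \<delta>' \<Longrightarrow> s \<in> {0..L} \<Longrightarrow> s + h \<in> {0..L} \<Longrightarrow> t \<in> {0..L} \<Longrightarrow> t + h \<in> {0..L} \<Longrightarrow>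
      \<bar>s - t\<bar> = real k * h \<Longrightarrow>
      \<bar>rect_increment g s (s + h) t (t + h)\<bar> \<le> C' * (h powr p * max 1 (real k) powr (p - 2))"
    using cell_boundedE[OF assms(2)] by metis
  show ?thesis
  proof (rule cell_boundedI[of "C + C'" "min \<delta> \<delta>'"])
    fix h s t k
    assume *: "0 < h" "h < min \<delta> \<delta>'" "real k * h < min \<delta> \<delta>'" "s \<in> {0..L}" "s + h \<in> {0..L}" "t \<in> {0..L}" "t + h \<in> {0..L}"
      "\<bar>s - t\<bar> = real k * h"
    have "rect_increment (\<lambda>s t. f s t + g s t) s (s + h) t (t + h)
      = rect_increment f s (s + h) t (t + h) + rect_increment g s (s + h) t (t + h)"
      by (simp add: rect_increment_def)
    then show "\<bar>rect_increment (\<lambda>s t. f s t + g s t) s (s + h) t (t + h)\<bar>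
       \<le> (C + C') * (h powr p * max 1 (real k) powr (p - 2))"
      using f(3)[of h k s t] g(3)[of h k s t] * by (simp add: distrib_right)
  qed (use f g in auto)
qed

lemma cell_bounded_cong:
  assumes "cell_bounded L p f" "\<And>s t. s \<in> {0..L} \<Longrightarrow> t \<in> {0..L} \<Longrightarrow> f s t = g s t"
  shows "cell_bounded L p g"
proof -
  obtain C \<delta> where f: "0 \<le> C" "0 < \<delta>"
    "\<And>h s t k. 0 < h \<Longrightarrow> h < \<delta> \<Longrightarrow> real k * h < \<delta> \<Longrightarrow> s \<in> {0..L} \<Longrightarrow> s + h \<in> {0..L} \<Longrightarrow> t \<in> {0..L} \<Longrightarrow> t + h \<in> {0..L} \<Longrightarrow>
      \<bar>s - t\<bar> = real k * h \<Longrightarrow>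
      \<bar>rect_increment f s (s + h) t (t + h)\<bar> \<le> C * (h powr p * max 1 (real k) powr (p - 2))"
    using cell_boundedE[OF assms(1)] by metis
  show ?thesis
    by (rule cell_boundedI[of C \<delta>])
       (use f(1,2) f(3) in \<open>auto simp: rect_increment_def assms(2)[symmetric]\<close>)
qed

text \<open>With \<open>d = max 1 k * h\<close> the two sides are \<open>h ^ 2\<close> times
  \<open>d powr (p - 2)\<close> and \<open>d powr (q - 2)\<close>; since \<open>d \<le> 1\<close>,
  the smaller exponent gives the larger value.\<close>

lemma cell_scale_mono:
  fixes h k p q :: real
  assumes "0 < h" "max 1 k * h \<le> 1" "q \<le> p"
  shows "h powr p * max 1 k powr (p - 2) \<le> h powr q * max 1 k powr (q - 2)"
proof -
  have "h powr p * max 1 k powr (p - 2) = (h powr q * max 1 k powr (q - 2)) * (max 1 k * h) powr (p - q)"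
    using assms(1) by (simp add: powr_mult powr_diff field_simps)
  also have "\<dots> \<le> (h powr q * max 1 k powr (q - 2)) * 1"
    using assms by (intro mult_left_mono powr_le1) auto
  finally show ?thesis by simp
qed

lemma cell_bounded_mono:
  assumes "cell_bounded L p f" "q \<le> p"
  shows "cell_bounded L q f"
proof -
  obtain C \<delta> where f: "0 \<le> C" "0 < \<delta>"
    "\<And>h s t k. 0 < h \<Longrightarrow> h < \<delta> \<Longrightarrow> real k * h < \<delta> \<Longrightarrow> s \<in> {0..L} \<Longrightarrow> s + h \<in> {0..L} \<Longrightarrow> t \<in> {0..L} \<Longrightarrow> t + h \<in> {0..L} \<Longrightarrow>
      \<bar>s - t\<bar> = real k * h \<Longrightarrow>
      \<bar>rect_increment f s (s + h) t (t + h)\<bar> \<le> C * (h powr p * max 1 (real k) powr (p - 2))"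
    using cell_boundedE[OF assms(1)] by metis
  show ?thesis
  proof (rule cell_boundedI[OF f(1,2)])
    fix h s t k
    assume *: "0 < h" "h < \<delta>" "max 1 (real k) * h \<le> 1" "real k * h < \<delta>" "s \<in> {0..L}" "s + h \<in> {0..L}" "t \<in> {0..L}" "t + h \<in> {0..L}"
      "\<bar>s - t\<bar> = real k * h"
    have "\<bar>rect_increment f s (s + h) t (t + h)\<bar> \<le> C * (h powr p * max 1 (real k) powr (p - 2))"
      using f(3) * by simp
    also have "\<dots> \<le> C * (h powr q * max 1 (real k) powr (q - 2))"
      using cell_scale_mono[OF *(1,3) assms(2)] f(1) by (intro mult_left_mono) auto
    finally show "\<bar>rect_increment f s (s + h) t (t + h)\<bar> \<le> C * (h powr q * max 1 (real k) powr (q - 2))" .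
  qed
qed

section \<open>Analytic terms of the expansion\<close>

lemma cell_bounded_analytic:
  assumes "real_analytic2_on f ({0..L} \<times> {0..L})" "0 < L"
  shows "cell_bounded L 2 f"
proof -
  obtain C \<delta> where f: "0 < \<delta>" "\<And>a. a \<in> {0..L} \<Longrightarrow> bi_lipschitz_on ({0..L} \<inter> ball a \<delta>) C f"
    using real_analytic2_on_bi_lipschitz[OF assms] by blast
  have "0 \<le> C" using f(2)[of 0] assms(2) by (auto simp: bi_lipschitz_on_def)
  \<comment> \<open>Halving \<open>\<delta>\<close> keeps all four corners within
    \<open>\<delta>\<close> of \<open>s\<close>. At exponent 2 the factor in \<open>k\<close> is 1,
    so the rectangular Lipschitz bound is already the claim.\<close>
  then show ?thesis
  proof (rule cell_boundedI[of C "\<delta> / 2"])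
    fix h s t k
    assume *: "0 < h" "h < \<delta> / 2" "real k * h < \<delta> / 2" "s \<in> {0..L}" "s + h \<in> {0..L}" "t \<in> {0..L}" "t + h \<in> {0..L}"
      "\<bar>s - t\<bar> = real k * h"
    let ?B = "{0..L} \<inter> ball s \<delta>"
    have "s \<in> ?B" "s + h \<in> ?B" "t \<in> ?B" "t + h \<in> ?B" using * f(1) by (auto simp: dist_real_def abs_if split: if_splits)
    then have "\<bar>rect_increment f s (s + h) t (t + h)\<bar> \<le> C * \<bar>s + h - s\<bar> * \<bar>t + h - t\<bar>"
      using f(2)[OF *(4)] unfolding bi_lipschitz_on_def by blast
    then show "\<bar>rect_increment f s (s + h) t (t + h)\<bar> \<le> C * (h powr 2 * max 1 (real k) powr (2 - 2))"
      using *(1) by (simp add: power2_eq_square max_def)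
  qed (use f in auto)
qed

text \<open>Differences of \<open>u powr a\<close> along the integers decay as the derivatives do:
  each order costs one power of \<open>k\<close>. The absolute value of \<open>real k - 1\<close>
  accounts for \<open>k = 0\<close>, whose two neighbours both lie at distance 1.\<close>

lemma grid_power_bounds:
  fixes a :: real
  assumes "0 < a"
  obtains C where "0 \<le> C"
    "\<And>k::nat. \<bar>(real k + 1) powr a - real k powr a\<bar> \<le> C * max 1 (real k) powr (a - 1)"
    "\<And>k::nat. \<bar>\<bar>real k - 1\<bar> powr a - real k powr a\<bar> \<le> C * max 1 (real k) powr (a - 1)"
    "\<And>k::nat. \<bar>2 * real k powr a - (real k + 1) powr a - \<bar>real k - 1\<bar> powr a\<bar> \<le> C * max 1 (real k) powr (a - 2)"
proof -
  have 1: "(\<lambda>k::nat. (real k + 1) powr a - real k powr a) \<in> O(\<lambda>k. max 1 (real k) powr (a - 1))"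
    using assms by real_asymp
  have 2: "(\<lambda>k::nat. \<bar>real k - 1\<bar> powr a - real k powr a) \<in> O(\<lambda>k. max 1 (real k) powr (a - 1))"
    using assms by real_asymp
  have 3: "(\<lambda>k::nat. 2 * real k powr a - (real k + 1) powr a - \<bar>real k - 1\<bar> powr a) \<in> O(\<lambda>k. max 1 (real k) powr (a - 2))"
  proof (cases "a = 1")
    \<comment> \<open>The leading coefficient \<open>a * (a - 1)\<close> vanishes here, so the
      generic rate is lost; the difference is exactly 0 from \<open>k = 1\<close> on.\<close>
    case True
    have "\<forall>\<^sub>F k::nat in at_top. 2 * real k powr a - (real k + 1) powr a - \<bar>real k - 1\<bar> powr a = 0"
      using eventually_ge_at_top[of 1] by eventually_elim (simp add: True)
    then show ?thesis by (rule landau_o.big.in_cong[THEN iffD2]) simp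
  next
    case False
    with assms show ?thesis by real_asymp
  qed
  obtain C1 where C1: "0 \<le> C1" "\<And>k::nat. \<bar>(real k + 1) powr a - real k powr a\<bar> \<le> C1 * max 1 (real k) powr (a - 1)"
    by (rule bigo_nat_imp_bound[OF 1]) (auto simp: max_def)
  obtain C2 where C2: "0 \<le> C2" "\<And>k::nat. \<bar>\<bar>real k - 1\<bar> powr a - real k powr a\<bar> \<le> C2 * max 1 (real k) powr (a - 1)"
    by (rule bigo_nat_imp_bound[OF 2]) (auto simp: max_def)
  obtain C3 where C3: "0 \<le> C3" "\<And>k::nat. \<bar>2 * real k powr a - (real k + 1) powr a - \<bar>real k - 1\<bar> powr a\<bar> \<le> C3 * max 1 (real k) powr (a - 2)"
    by (rule bigo_nat_imp_bound[OF 3]) (auto simp: max_def)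
  have up: "x \<le> (C1 + C2 + C3) * y powr z" if "x \<le> D * y powr z" "D \<le> C1 + C2 + C3" for x y z D :: real
    using that by (meson mult_right_mono order_trans powr_ge_zero)
  show ?thesis
    by (rule that[of "C1 + C2 + C3"]) (use C1 C2 C3 in \<open>auto intro!: up\<close>)
qed

text \<open>Moving an increment from the power to the analytic factor changes the bound by a
  constant times \<open>max 1 (real k) * h\<close>, which is at most 1. The bound for the full
  second difference of the power thus covers all terms of the product rule, up to constants.\<close>

lemma cell_bounded_analytic_times_power:
  assumes "real_analytic2_on f ({0..L} \<times> {0..L})" "0 < L" "0 < a"
  shows "cell_bounded L a (\<lambda>s t. f s t * \<bar>s - t\<bar> powr a)"
proof -
  obtain C \<delta> where f: "0 < \<delta>" "\<And>a. a \<in> {0..L} \<Longrightarrow> bi_lipschitz_on ({0..L} \<inter> ball a \<delta>) C f"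
    using real_analytic2_on_bi_lipschitz[OF assms(1,2)] by blast
  have C: "0 \<le> C" using f(2)[of 0] assms(2) by (auto simp: bi_lipschitz_on_def)
  obtain D where D: "0 \<le> D"
    "\<And>k::nat. \<bar>(real k + 1) powr a - real k powr a\<bar> \<le> D * max 1 (real k) powr (a - 1)"
    "\<And>k::nat. \<bar>\<bar>real k - 1\<bar> powr a - real k powr a\<bar> \<le> D * max 1 (real k) powr (a - 1)"
    "\<And>k::nat. \<bar>2 * real k powr a - (real k + 1) powr a - \<bar>real k - 1\<bar> powr a\<bar> \<le> D * max 1 (real k) powr (a - 2)"
    using grid_power_bounds[OF assms(3)] by metis
  \<comment> \<open>The constant counts one second difference and two products of first differences,
    each at most \<open>C * D\<close>, and one term with the whole increment on \<open>f\<close>, at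
    most \<open>C\<close>.\<close>
  show ?thesis
  proof (rule cell_boundedI[of "C * (3 * D + 1)" "\<delta> / 2"])
    fix h s t k
    assume *: "0 < h" "h < \<delta> / 2" "h \<le> 1" "real k * h < \<delta> / 2" "real k * h \<le> 1" "max 1 (real k) * h \<le> 1"
      "s \<in> {0..L}" "s + h \<in> {0..L}" "t \<in> {0..L}" "t + h \<in> {0..L}" "\<bar>s - t\<bar> = real k * h"
    let ?B = "{0..L} \<inter> ball s \<delta>"
    let ?m = "max 1 (real k)"
    let ?r = "h powr a * ?m powr (a - 2)"
    have B: "s \<in> ?B" "s + h \<in> ?B" "t \<in> ?B" "t + h \<in> ?B" using * f(1) by (auto simp: dist_real_def abs_if split: if_splits)
    note bl = bi_lipschitz_onD[OF f(2)[OF *(7)]]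
    have b1: "\<bar>f (s + h) (t + h)\<bar> \<le> C" "\<bar>f (s + h) (t + h) - f (s + h) t\<bar> \<le> C * h" "\<bar>f (s + h) (t + h) - f s (t + h)\<bar> \<le> C * h"
      "\<bar>rect_increment f s (s + h) t (t + h)\<bar> \<le> C * h * h"
      using bl(1)[of "s + h" s "t + h" t] bl(3)[of "s + h" s "t + h" t] bl(2)[of "s + h" s "t + h" t] bl(4)[of s "s + h" t "t + h"] B *(1)
      by simp_all
    define \<phi> :: "real \<Rightarrow> real \<Rightarrow> real" where "\<phi> u v = \<bar>u - v\<bar> powr a" for u v
    have p00: "\<phi> s t = h powr a * real k powr a" "\<phi> (s + h) (t + h) = h powr a * real k powr a"
      using * by (auto simp: \<phi>_def powr_mult)
    \<comment> \<open>At the corners \<open>(s + h, t)\<close> and \<open>(s, t + h)\<close> the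
      arguments differ by \<open>(k + 1) * h\<close> and \<open>\<bar>k - 1\<bar> * h\<close>, in an
      order that depends on the sign of \<open>s - t\<close>.\<close>
    have pm: "(\<phi> (s + h) t = h powr a * (real k + 1) powr a \<and> \<phi> s (t + h) = h powr a * \<bar>real k - 1\<bar> powr a) \<or>
        (\<phi> (s + h) t = h powr a * \<bar>real k - 1\<bar> powr a \<and> \<phi> s (t + h) = h powr a * (real k + 1) powr a)"
    proof (cases "t \<le> s")
      case True
      then have "s + h - t = (real k + 1) * h" "s - (t + h) = (real k - 1) * h"
        using *(11) by (simp_all add: algebra_simps)
      then have "\<bar>s + h - t\<bar> = (real k + 1) * h" "\<bar>s - (t + h)\<bar> = \<bar>real k - 1\<bar> * h"
        using *(1) by (simp_all add: abs_mult)
      then show ?thesis using *(1) by (auto simp: \<phi>_def powr_mult)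
    next
      case False
      then have "s + h - t = - ((real k - 1) * h)" "s - (t + h) = - ((real k + 1) * h)"
        using *(11) by (simp_all add: algebra_simps)
      then have "\<bar>s + h - t\<bar> = \<bar>real k - 1\<bar> * h" "\<bar>s - (t + h)\<bar> = (real k + 1) * h"
        using *(1) by (simp_all add: abs_mult)
      then show ?thesis using *(1) by (auto simp: \<phi>_def powr_mult)
    qed
    have "rect_increment \<phi> s (s + h) t (t + h) = h powr a * (2 * real k powr a - (real k + 1) powr a - \<bar>real k - 1\<bar> powr a)"
      using pm p00 by (auto simp: rect_increment_def algebra_simps)
    then have q1: "\<bar>rect_increment \<phi> s (s + h) t (t + h)\<bar> \<le> D * ?r"
      using mult_left_mono[OF D(4)[of k], of "h powr a"] by (simp add: abs_mult mult_ac)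
    have q2': "\<bar>\<phi> (s + h) t - \<phi> s t\<bar> \<le> h powr a * (D * ?m powr (a - 1))" "\<bar>\<phi> s (t + h) - \<phi> s t\<bar> \<le> h powr a * (D * ?m powr (a - 1))"
      using pm p00 mult_left_mono[OF D(2)[of k], of "h powr a"] mult_left_mono[OF D(3)[of k], of "h powr a"]
      by (auto simp: abs_mult right_diff_distrib[symmetric])
    have "h * (h powr a * (D * ?m powr (a - 1))) = D * ?r * (?m * h)"
      by (simp add: powr_diff power2_eq_square field_simps)
    also have "\<dots> \<le> D * ?r * 1" using *(6) D(1) by (intro mult_left_mono) auto
    finally have q2: "h * (h powr a * (D * ?m powr (a - 1))) \<le> D * ?r" by simp
    have "h * h * \<phi> s t \<le> h * h * (h powr a * ?m powr a)"
      using *(1) assms(3) by (auto simp: p00 intro!: mult_left_mono powr_mono2)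
    also have "\<dots> = ?r * (?m * h)\<^sup>2"
      by (simp add: powr_diff power2_eq_square field_simps)
    also have "\<dots> \<le> ?r * 1" using *(1,6) by (intro mult_left_mono power_le_one) auto
    finally have q3: "h * h * \<phi> s t \<le> ?r" by simp
    \<comment> \<open>A discrete product rule; no derivatives of \<open>f\<close> are needed.\<close>
    have eq: "rect_increment (\<lambda>s t. f s t * \<bar>s - t\<bar> powr a) s (s + h) t (t + h) =
        f (s + h) (t + h) * rect_increment \<phi> s (s + h) t (t + h)
        + (f (s + h) (t + h) - f (s + h) t) * (\<phi> (s + h) t - \<phi> s t)
        + (f (s + h) (t + h) - f s (t + h)) * (\<phi> s (t + h) - \<phi> s t)
        + rect_increment f s (s + h) t (t + h) * \<phi> s t"
      unfolding rect_increment_def \<phi>_def[symmetric] using p00 by (simp add: algebra_simps)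
    have "\<bar>f (s + h) (t + h) * rect_increment \<phi> s (s + h) t (t + h)\<bar> \<le> C * (D * ?r)"
      unfolding abs_mult by (intro mult_mono b1 q1 C) simp
    moreover have "\<bar>(f (s + h) (t + h) - f (s + h) t) * (\<phi> (s + h) t - \<phi> s t)\<bar> \<le> C * h * (h powr a * (D * ?m powr (a - 1)))"
      unfolding abs_mult using C *(1) by (intro mult_mono b1 q2') simp_all
    moreover have "\<bar>(f (s + h) (t + h) - f s (t + h)) * (\<phi> s (t + h) - \<phi> s t)\<bar> \<le> C * h * (h powr a * (D * ?m powr (a - 1)))"
      unfolding abs_mult using C *(1) by (intro mult_mono b1 q2') simp_all
    moreover have "\<bar>rect_increment f s (s + h) t (t + h) * \<phi> s t\<bar> \<le> C * h * h * \<phi> s t"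
      unfolding abs_mult using C *(1) by (intro mult_mono b1) (simp_all add: p00)
    moreover have "C * h * (h powr a * (D * ?m powr (a - 1))) \<le> C * (D * ?r)"
      using mult_left_mono[OF q2 C] by (simp only: mult.assoc)
    moreover have "C * h * h * \<phi> s t \<le> C * ?r"
      using mult_left_mono[OF q3 C] by (simp only: mult.assoc)
    moreover have "C * (3 * D + 1) * ?r = C * (D * ?r) + C * (D * ?r) + C * (D * ?r) + C * ?r"
      by (simp add: algebra_simps)
    ultimately show "\<bar>rect_increment (\<lambda>s t. f s t * \<bar>s - t\<bar> powr a) s (s + h) t (t + h)\<bar> \<le> C * (3 * D + 1) * ?r"
      unfolding eq by linarith
  qed (use f C D in auto)
qed

section \<open>Remainder terms near the diagonal\<close>

lemma eventually_near_diagonal: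
  "(\<forall>\<^sub>F (s, t) in near_diagonal L. P s t) \<longleftrightarrow>
     (\<exists>\<delta>>0. \<forall>s\<in>{0..L}. \<forall>t\<in>{0..L}. 0 < \<bar>s - t\<bar> \<longrightarrow> \<bar>s - t\<bar> < \<delta> \<longrightarrow> P s t)"
proof
  assume "\<forall>\<^sub>F (s, t) in near_diagonal L. P s t"
  then obtain Q where Q: "eventually Q (at_right 0)" "\<And>s t. Q \<bar>s - t\<bar> \<Longrightarrow> s \<in> {0..L} \<Longrightarrow> t \<in> {0..L} \<Longrightarrow> P s t"
    by (auto simp: near_diagonal_def eventually_inf_principal eventually_filtercomap)
  then show "\<exists>\<delta>>0. \<forall>s\<in>{0..L}. \<forall>t\<in>{0..L}. 0 < \<bar>s - t\<bar> \<longrightarrow> \<bar>s - t\<bar> < \<delta> \<longrightarrow> P s t"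
    by (auto simp: eventually_at_right_field)
next
  assume "\<exists>\<delta>>0. \<forall>s\<in>{0..L}. \<forall>t\<in>{0..L}. 0 < \<bar>s - t\<bar> \<longrightarrow> \<bar>s - t\<bar> < \<delta> \<longrightarrow> P s t"
  then obtain \<delta> where \<delta>: "\<delta> > 0" "\<And>s t. s \<in> {0..L} \<Longrightarrow> t \<in> {0..L} \<Longrightarrow> 0 < \<bar>s - t\<bar> \<Longrightarrow> \<bar>s - t\<bar> < \<delta> \<Longrightarrow> P s t" by blast
  have "eventually (\<lambda>u. 0 < u \<and> u < \<delta>) (at_right (0::real))"
    using \<delta>(1) by (auto simp: eventually_at_right_field)
  then show "\<forall>\<^sub>F (s, t) in near_diagonal L. P s t"
    unfolding near_diagonal_def eventually_inf_principal eventually_filtercomap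
    by (intro exI conjI) (use \<delta>(2) in auto)
qed

text \<open>The quotient-free form of comparability transfers the zero \<open>\<rho> 0 = 0\<close>
  to \<open>r\<close>. The order bounds on \<open>r\<close> leave out the diagonal, so it has to be
  treated separately.\<close>

lemma remainder_term_diagonal:
  assumes "remainder_term L p r" "s \<in> {0..L}"
  shows "r s s = 0"
proof -
  obtain \<rho> where "comparable_on ({0..L} \<times> {0..L}) (\<lambda>(s, s'). r s s') (\<lambda>(s, s'). \<rho> \<bar>s - s'\<bar>)" and \<rho>: "\<rho> 0 = 0"
    using assms(1) unfolding remainder_term_def small_with_derivs_def by blast
  then obtain C where "\<forall>x\<in>{0..L} \<times> {0..L}. \<bar>case x of (s, s') \<Rightarrow> r s s'\<bar> \<le> C * \<bar>case x of (s, s') \<Rightarrow> \<rho> \<bar>s - s'\<bar>\<bar>"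
    unfolding comparable_on_def by blast
  from bspec[OF this, of "(s, s)"] show ?thesis using assms(2) \<rho> by simp
qed

text \<open>Order zero of the bounds on the partial derivatives, extended to the diagonal, where
  both sides are 0.\<close>

lemma remainder_term_small:
  assumes "remainder_term L p r" "0 < \<epsilon>"
  obtains \<delta> where "0 < \<delta>" "\<And>s t. s \<in> {0..L} \<Longrightarrow> t \<in> {0..L} \<Longrightarrow> \<bar>s - t\<bar> < \<delta> \<Longrightarrow> \<bar>r s t\<bar> \<le> \<epsilon> * \<bar>s - t\<bar> powr p"
proof -
  have "(\<lambda>(s, t). r s t) \<in> o[near_diagonal L](\<lambda>(s, t). \<bar>s - t\<bar> powr p)"
  proof -
    obtain R where R: "R 0 0 = r" "\<And>j l. (\<lambda>(s, s'). R j l s s') \<in>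
        o[near_diagonal L](\<lambda>(s, s'). \<bar>s - s'\<bar> powr (p - real (j + l)))"
      using assms(1) unfolding remainder_term_def small_with_partial_derivs_def by blast
    then show ?thesis using R(2)[of 0 0] by simp
  qed
  then have "\<forall>\<^sub>F (s, t) in near_diagonal L. \<bar>r s t\<bar> \<le> \<epsilon> * \<bar>s - t\<bar> powr p"
    using assms(2) by (auto dest!: landau_o.smallD simp: case_prod_unfold)
  then obtain \<delta> where "\<delta> > 0" "\<And>s t. s \<in> {0..L} \<Longrightarrow> t \<in> {0..L} \<Longrightarrow> 0 < \<bar>s - t\<bar> \<Longrightarrow> \<bar>s - t\<bar> < \<delta> \<Longrightarrow> \<bar>r s t\<bar> \<le> \<epsilon> * \<bar>s - t\<bar> powr p"
    unfolding eventually_near_diagonal by blast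
  then show ?thesis
    using remainder_term_diagonal[OF assms(1)]
    by (intro that[of \<delta>]) (metis abs_zero diff_self less_eq_real_def mult_zero_right powr_0 zero_less_abs_iff right_minus_eq)+
qed

text \<open>Differentiating first in \<open>s\<close> and then in \<open>t\<close> matches the two
  applications of the mean value theorem to come. The little-o bound on the mixed derivative is read
  off with constant 1.\<close>

lemma remainder_term_mixed_derivative:
  assumes "remainder_term L p r"
  obtains \<delta> r\<^sub>1 r\<^sub>1\<^sub>1 where "0 < \<delta>"
    "\<And>s t. s \<in> {0..L} \<Longrightarrow> t \<in> {0..L} \<Longrightarrow> 0 < \<bar>s - t\<bar> \<Longrightarrow> \<bar>s - t\<bar> < \<delta> \<Longrightarrow>
       ((\<lambda>u. r u t) has_real_derivative r\<^sub>1 s t) (at s within {0..L})"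
    "\<And>s t. s \<in> {0..L} \<Longrightarrow> t \<in> {0..L} \<Longrightarrow> 0 < \<bar>s - t\<bar> \<Longrightarrow> \<bar>s - t\<bar> < \<delta> \<Longrightarrow>
       ((\<lambda>u. r\<^sub>1 s u) has_real_derivative r\<^sub>1\<^sub>1 s t) (at t within {0..L})"
    "\<And>s t. s \<in> {0..L} \<Longrightarrow> t \<in> {0..L} \<Longrightarrow> 0 < \<bar>s - t\<bar> \<Longrightarrow> \<bar>s - t\<bar> < \<delta> \<Longrightarrow>
       \<bar>r\<^sub>1\<^sub>1 s t\<bar> \<le> \<bar>s - t\<bar> powr (p - 2)"
proof -
  obtain R where R: "R 0 0 = r"
    "\<And>j l. \<forall>\<^sub>F (s, s') in near_diagonal L.
                  ((\<lambda>u. R j l u s') has_real_derivative R (Suc j) l s s') (at s within {0..L}) \<and>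
                  ((\<lambda>u. R j l s u) has_real_derivative R j (Suc l) s s') (at s' within {0..L})"
    "\<And>j l. (\<lambda>(s, s'). R j l s s') \<in> o[near_diagonal L](\<lambda>(s, s'). \<bar>s - s'\<bar> powr (p - real (j + l)))"
    using assms unfolding remainder_term_def small_with_partial_derivs_def by blast
  have "\<forall>\<^sub>F (s, t) in near_diagonal L. \<bar>R 1 1 s t\<bar> \<le> \<bar>s - t\<bar> powr (p - 2)"
    using landau_o.smallD[OF R(3)[of 1 1], of 1] by (simp add: case_prod_unfold)
  then have "\<forall>\<^sub>F (s, t) in near_diagonal L.
      ((\<lambda>u. R 0 0 u t) has_real_derivative R 1 0 s t) (at s within {0..L}) \<and>
      ((\<lambda>u. R 1 0 s u) has_real_derivative R 1 1 s t) (at t within {0..L}) \<and>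
      \<bar>R 1 1 s t\<bar> \<le> \<bar>s - t\<bar> powr (p - 2)"
    using R(2)[of 0 0] R(2)[of 1 0] by eventually_elim auto
  then obtain \<delta> where "\<delta> > 0" "\<forall>s\<in>{0..L}. \<forall>t\<in>{0..L}. 0 < \<bar>s - t\<bar> \<longrightarrow> \<bar>s - t\<bar> < \<delta> \<longrightarrow>
      ((\<lambda>u. R 0 0 u t) has_real_derivative R 1 0 s t) (at s within {0..L}) \<and>
      ((\<lambda>u. R 1 0 s u) has_real_derivative R 1 1 s t) (at t within {0..L}) \<and>
      \<bar>R 1 1 s t\<bar> \<le> \<bar>s - t\<bar> powr (p - 2)"
    unfolding eventually_near_diagonal by blast
  then show ?thesis by (intro that[of \<delta> "R 1 0" "R 1 1"]) (auto simp: R(1))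
qed

text \<open>Derivatives relative to \<open>S\<close> admit one-sided derivatives, which occur at the
  boundary of the square.\<close>

lemma real_mvt_within:
  fixes f :: "real \<Rightarrow> real"
  assumes "a < b" "{a..b} \<subseteq> S" "\<And>x. x \<in> {a..b} \<Longrightarrow> (f has_real_derivative f' x) (at x within S)"
  obtains x where "x \<in> {a..b}" "f b - f a = f' x * (b - a)"
proof -
  have "\<exists>x\<in>{a<..<b}. f b - f a = (*) (f' x) (b - a)"
  proof (rule mvt_simple[OF assms(1)])
    fix x assume "a \<le> x" "x \<le> b"
    then show "(f has_derivative (*) (f' x)) (at x within {a..b})"
      using assms(3)[of x] has_field_derivative_subset[OF _ assms(2)] by (simp add: has_field_derivative_def)
  qed
  then obtain x where "x \<in> {a<..<b}" "f b - f a = f' x * (b - a)" by blast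
  then show ?thesis by (intro that[of x]) auto
qed

text \<open>For \<open>k \<ge> 2\<close> the cell keeps away from the diagonal, and two applications
  of the mean value theorem give \<open>h ^ 2\<close> times a mixed derivative at a distance of at
  least half of \<open>k * h\<close>. For \<open>k \<le> 1\<close> the cell meets the diagonal,
  where \<open>r\<close> may fail to be smooth, and the size of \<open>r\<close> at the four corners
  is used instead.\<close>

lemma cell_bounded_remainder:
  assumes "remainder_term L p r" "0 < p" "p \<le> 2"
  shows "cell_bounded L p r"
proof -
  obtain \<delta> r1 r11 where \<delta>: "0 < \<delta>" and d:
    "\<And>s t. s \<in> {0..L} \<Longrightarrow> t \<in> {0..L} \<Longrightarrow> 0 < \<bar>s - t\<bar> \<Longrightarrow> \<bar>s - t\<bar> < \<delta> \<Longrightarrow>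
       ((\<lambda>u. r u t) has_real_derivative r1 s t) (at s within {0..L})"
    "\<And>s t. s \<in> {0..L} \<Longrightarrow> t \<in> {0..L} \<Longrightarrow> 0 < \<bar>s - t\<bar> \<Longrightarrow> \<bar>s - t\<bar> < \<delta> \<Longrightarrow>
       ((\<lambda>u. r1 s u) has_real_derivative r11 s t) (at t within {0..L})"
    "\<And>s t. s \<in> {0..L} \<Longrightarrow> t \<in> {0..L} \<Longrightarrow> 0 < \<bar>s - t\<bar> \<Longrightarrow> \<bar>s - t\<bar> < \<delta> \<Longrightarrow>
       \<bar>r11 s t\<bar> \<le> \<bar>s - t\<bar> powr (p - 2)"
    using remainder_term_mixed_derivative[OF assms(1)] by blast
  obtain \<delta>' where \<delta>': "0 < \<delta>'" "\<And>s t. s \<in> {0..L} \<Longrightarrow> t \<in> {0..L} \<Longrightarrow> \<bar>s - t\<bar> < \<delta>' \<Longrightarrow> \<bar>r s t\<bar> \<le> \<bar>s - t\<bar> powr p"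
    using remainder_term_small[OF assms(1), of 1] by auto
  \<comment> \<open>The first summand bounds four corner values at distance at most
    \<open>2 * h\<close>; the second is the loss from halving the distance under the exponent
    \<open>p - 2\<close>.\<close>
  define C where "C = 4 * 2 powr p + (1 / 2) powr (p - 2)"
  show ?thesis
  proof (rule cell_boundedI[of C "min (\<delta> / 2) (\<delta>' / 2)"])
    fix h s t k
    assume *: "0 < h" "h < min (\<delta> / 2) (\<delta>' / 2)" "real k * h < min (\<delta> / 2) (\<delta>' / 2)"
      "s \<in> {0..L}" "s + h \<in> {0..L}" "t \<in> {0..L}" "t + h \<in> {0..L}" "\<bar>s - t\<bar> = real k * h"
    show "\<bar>rect_increment r s (s + h) t (t + h)\<bar> \<le> C * (h powr p * max 1 (real k) powr (p - 2))"
    proof (cases "k \<le> 1")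
      case True
      have kh: "real k * h \<le> h" using True *(1) mult_right_mono[of "real k" 1 h] by simp
      have b: "\<bar>r u v\<bar> \<le> (2 * h) powr p" if "u \<in> {0..L}" "v \<in> {0..L}" "\<bar>u - v\<bar> \<le> 2 * h" for u v
      proof -
        have "\<bar>r u v\<bar> \<le> \<bar>u - v\<bar> powr p" using that *(2) by (intro \<delta>'(2)) auto
        also have "\<dots> \<le> (2 * h) powr p" using that assms(2) by (intro powr_mono2) auto
        finally show ?thesis .
      qed
      have "\<bar>rect_increment r s (s + h) t (t + h)\<bar> \<le> 4 * (2 * h) powr p"
      proof -
        have "\<bar>s - t\<bar> \<le> 2 * h" "\<bar>s + h - t\<bar> \<le> 2 * h" "\<bar>s - (t + h)\<bar> \<le> 2 * h" "\<bar>s + h - (t + h)\<bar> \<le> 2 * h"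
          using *(1,8) kh by linarith+
        then have "\<bar>r s t\<bar> \<le> (2 * h) powr p" "\<bar>r (s + h) t\<bar> \<le> (2 * h) powr p"
            "\<bar>r s (t + h)\<bar> \<le> (2 * h) powr p" "\<bar>r (s + h) (t + h)\<bar> \<le> (2 * h) powr p"
          using *(4-7) by (simp_all only: b)
        then show ?thesis unfolding rect_increment_def by linarith
      qed
      also have "\<dots> = 4 * 2 powr p * h powr p" using *(1) by (simp add: powr_mult)
      also have "\<dots> \<le> C * h powr p" by (intro mult_right_mono) (auto simp: C_def)
      finally have "\<bar>rect_increment r s (s + h) t (t + h)\<bar> \<le> C * h powr p" .
      moreover have "max 1 (real k) = 1" using True by simp
      ultimately show ?thesis by simp
    next
      case False
      then have k: "2 \<le> real k" by simp
      have "2 * h \<le> real k * h" using k *(1) by (intro mult_right_mono) auto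
      \<comment> \<open>A cell reaches back towards the diagonal by at most \<open>h\<close>, and
        \<open>k * h - h\<close> is at least half of \<open>k * h\<close> since
        \<open>k \<ge> 2\<close>.\<close>
      have near: "real k * h / 2 \<le> \<bar>u - v\<bar> \<and> \<bar>u - v\<bar> < \<delta> \<and> 0 < \<bar>u - v\<bar> \<and> u \<in> {0..L} \<and> v \<in> {0..L}"
        if "u \<in> {s..s + h}" "v \<in> {t..t + h}" for u v
      proof -
        have "real k * h - h \<le> \<bar>u - v\<bar>" "\<bar>u - v\<bar> \<le> real k * h + h"
          using that *(8) *(1) by (auto simp: abs_if split: if_splits)
        moreover have "h < \<delta> / 2" "real k * h < \<delta> / 2" using *(2,3) by auto
        ultimately have "real k * h / 2 \<le> \<bar>u - v\<bar>" "\<bar>u - v\<bar> < \<delta>" "0 < \<bar>u - v\<bar>"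
          using \<open>2 * h \<le> real k * h\<close> *(1) by linarith+
        then show ?thesis using that *(4-7) by auto
      qed
      have sub: "{s..s + h} \<subseteq> {0..L}" "{t..t + h} \<subseteq> {0..L}" using * by auto
      \<comment> \<open>The mean value theorem is applied to the difference of \<open>r\<close> at
        \<open>t + h\<close> and \<open>t\<close>, so that one \<open>\<xi>\<close> serves both
        values of the second argument.\<close>
      obtain \<xi> where \<xi>: "\<xi> \<in> {s..s + h}"
        "(r (s + h) (t + h) - r (s + h) t) - (r s (t + h) - r s t) = (r1 \<xi> (t + h) - r1 \<xi> t) * (s + h - s)"
      proof (rule real_mvt_within[of s "s + h" "{0..L}" "\<lambda>u. r u (t + h) - r u t" "\<lambda>u. r1 u (t + h) - r1 u t"])
        fix u assume "u \<in> {s..s + h}"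
        then show "((\<lambda>u. r u (t + h) - r u t) has_real_derivative r1 u (t + h) - r1 u t) (at u within {0..L})"
          using near[of u t] near[of u "t + h"] *(1) by (intro DERIV_diff d(1)) auto
      qed (use * sub in auto)
      obtain \<eta> where \<eta>: "\<eta> \<in> {t..t + h}" "r1 \<xi> (t + h) - r1 \<xi> t = r11 \<xi> \<eta> * (t + h - t)"
      proof (rule real_mvt_within[of t "t + h" "{0..L}" "r1 \<xi>" "r11 \<xi>"])
        fix u assume "u \<in> {t..t + h}"
        then show "(r1 \<xi> has_real_derivative r11 \<xi> u) (at u within {0..L})"
          using near[OF \<xi>(1), of u] by (intro d(2)) auto
      qed (use * sub in auto)
      note n = near[OF \<xi>(1) \<eta>(1)]
      have "\<bar>r11 \<xi> \<eta>\<bar> \<le> \<bar>\<xi> - \<eta>\<bar> powr (p - 2)" using n by (intro d(3)) auto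
      also have "\<dots> \<le> (real k * h / 2) powr (p - 2)"
        using n *(1) k assms(3) by (intro powr_mono2') auto
      also have "\<dots> = (1 / 2) powr (p - 2) * (real k powr (p - 2) * h powr (p - 2))"
        using *(1) k powr_mult[of "1 / 2" "real k * h" "p - 2"] by (simp add: powr_mult)
      also have "\<dots> \<le> C * (real k powr (p - 2) * h powr (p - 2))"
        by (intro mult_right_mono) (auto simp: C_def)
      finally have "\<bar>r11 \<xi> \<eta>\<bar> * h\<^sup>2 \<le> C * (real k powr (p - 2) * h powr (p - 2)) * h\<^sup>2"
        by (rule mult_right_mono) simp
      also have "\<dots> = C * (h powr p * real k powr (p - 2))"
        using *(1) by (simp add: powr_diff)
      finally show ?thesis
        using \<xi>(2) \<eta>(2) k *(1) by (simp add: rect_increment_def abs_mult power2_eq_square algebra_simps)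
    qed
  qed (use \<delta> \<delta>' in \<open>auto simp: C_def\<close>)
qed

lemma cell_bounded_class:
  assumes "in_class_K L \<alpha> K" "0 < L"
  shows "cell_bounded L (min \<alpha> 2) K"
proof -
  obtain G0 G2 G r where e: "has_expansion L \<alpha> K G0 G2 G r"
    using assms(1) unfolding in_class_K_def by blast
  note e' = e[unfolded has_expansion_def]
  \<comment> \<open>The quadratic term is written with \<open>powr 2\<close> so that it falls under
    the case of an analytic function times a power. The terms have exponents 2, 2,
    \<open>\<alpha>\<close> and \<open>min \<alpha> 2\<close>, all lowered to the last.\<close>
  have "cell_bounded L (min \<alpha> 2) (\<lambda>s t. G0 s t + G2 s t * \<bar>s - t\<bar> powr 2 + G s t * \<bar>s - t\<bar> powr \<alpha> + r s t)"
  proof (intro cell_bounded_add)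
    show "cell_bounded L (min \<alpha> 2) G0"
      by (rule cell_bounded_mono[OF cell_bounded_analytic]) (use e' assms(2) in auto)
    show "cell_bounded L (min \<alpha> 2) (\<lambda>s t. G2 s t * \<bar>s - t\<bar> powr 2)"
      by (rule cell_bounded_mono[OF cell_bounded_analytic_times_power]) (use e' assms(2) in auto)
    show "cell_bounded L (min \<alpha> 2) (\<lambda>s t. G s t * \<bar>s - t\<bar> powr \<alpha>)"
      by (rule cell_bounded_mono[OF cell_bounded_analytic_times_power]) (use e' assms(2) in auto)
    show "cell_bounded L (min \<alpha> 2) r"
      by (rule cell_bounded_remainder) (use e' in auto)
  qed
  then show ?thesis
    by (rule cell_bounded_cong) (use e' in auto)
qed

text \<open>On a diagonal cell the power vanishes at the two corners on the diagonal and equals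
  \<open>h powr a\<close> at the other two, which enter with a minus sign; hence
  \<open>- 2 * G s s\<close>. The smooth terms are of order \<open>h ^ 2\<close>, smaller since
  \<open>a < 2\<close>, and replacing the corner values of \<open>G\<close> by \<open>G s s\<close>
  costs only order \<open>h * h powr a\<close>.\<close>

lemma has_expansion_diagonal_increment:
  assumes "has_expansion L a K G0 G2 G r" "0 < L" "a < 2" "0 < \<epsilon>"
  shows "\<forall>\<^sub>F h in at_right 0. \<forall>s. s \<in> {0..L} \<longrightarrow> s + h \<in> {0..L} \<longrightarrow>
     \<bar>rect_increment K s (s + h) s (s + h) + 2 * G s s * h powr a\<bar> \<le> \<epsilon> * h powr a"
proof -
  note e = assms(1)[unfolded has_expansion_def]
  have "cell_bounded L 2 (\<lambda>s t. G0 s t + G2 s t * \<bar>s - t\<bar> powr 2)"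
    by (rule cell_bounded_add[OF cell_bounded_analytic cell_bounded_analytic_times_power])
       (use e assms(2) in auto)
  then obtain C \<delta> where C: "0 \<le> C" "0 < \<delta>" "\<And>h s. 0 < h \<Longrightarrow> h < \<delta> \<Longrightarrow> s \<in> {0..L} \<Longrightarrow> s + h \<in> {0..L} \<Longrightarrow>
      \<bar>rect_increment (\<lambda>s t. G0 s t + G2 s t * \<bar>s - t\<bar> powr 2) s (s + h) s (s + h)\<bar> \<le> C * h powr 2"
  proof (rule cell_boundedE, goal_cases)
    case (1 C \<delta>)
    show ?case
    proof (rule 1(1)[OF 1(2,3)])
      fix h s assume "0 < h" "h < \<delta>" "s \<in> {0..L}" "s + h \<in> {0..L}"
      then show "\<bar>rect_increment (\<lambda>s t. G0 s t + G2 s t * \<bar>s - t\<bar> powr 2) s (s + h) s (s + h)\<bar> \<le> C * h powr 2"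
        using 1(4)[of h 0 s s] 1(3) by (simp add: max_def)
    qed
  qed
  have an: "real_analytic2_on G ({0..L} \<times> {0..L})" and rt: "remainder_term L a r"
    using e assms(3) by (simp_all add: min_def)
  obtain D \<delta>1 where D: "0 < \<delta>1" "\<And>a. a \<in> {0..L} \<Longrightarrow> bi_lipschitz_on ({0..L} \<inter> ball a \<delta>1) D G"
    using real_analytic2_on_bi_lipschitz[OF an assms(2)] by blast
  \<comment> \<open>\<open>r\<close> enters at two corners with \<open>\<epsilon> / 4\<close> each,
    which leaves \<open>\<epsilon> / 2\<close> for the smooth terms and the variation of
    \<open>G\<close>.\<close>
  have e4: "0 < \<epsilon> / 4" using assms(4) by simp
  obtain \<delta>2 where \<delta>2: "0 < \<delta>2" "\<And>s t. s \<in> {0..L} \<Longrightarrow> t \<in> {0..L} \<Longrightarrow> \<bar>s - t\<bar> < \<delta>2 \<Longrightarrow> \<bar>r s t\<bar> \<le> \<epsilon> / 4 * \<bar>s - t\<bar> powr a"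
    using remainder_term_small[OF rt e4] by blast
  have "((\<lambda>h. C * h powr (2 - a) + 2 * D * h) \<longlongrightarrow> C * 0 + 2 * D * 0) (at_right 0)"
    by (intro tendsto_intros) (use assms(3) in real_asymp)
  then have "\<forall>\<^sub>F h in at_right 0. C * h powr (2 - a) + 2 * D * h < \<epsilon> / 2"
    by (rule order_tendstoD) (use assms(4) in auto)
  moreover have "\<forall>\<^sub>F h in at_right (0::real). 0 < h \<and> h < min \<delta> (min \<delta>1 \<delta>2)"
    using C(2) D(1) \<delta>2(1) by (auto simp: eventually_at_right_field intro!: exI[of _ "min \<delta> (min \<delta>1 \<delta>2)"])
  ultimately show ?thesis
  proof eventually_elim
    case (elim h)
    show ?case
    proof (intro allI impI)
      fix s assume s: "s \<in> {0..L}" "s + h \<in> {0..L}"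
      have h: "0 < h" "h < \<delta>" "h < \<delta>1" "h < \<delta>2" using elim by auto
      have m: "s \<in> {0..L} \<inter> ball s \<delta>1" "s + h \<in> {0..L} \<inter> ball s \<delta>1" using s h by (auto simp: dist_real_def)
      have t1: "\<bar>rect_increment (\<lambda>s t. G0 s t + G2 s t * \<bar>s - t\<bar> powr 2) s (s + h) s (s + h)\<bar> \<le> C * h powr 2"
        using C(3)[of h s] h s by simp
      have g: "\<bar>G s s - G (s + h) s\<bar> \<le> D * h" "\<bar>G s s - G s (s + h)\<bar> \<le> D * h"
        using bi_lipschitz_onD(2,3)[OF D(2)[OF s(1)] m m] h by simp_all
      have t2: "\<bar>(2 * G s s - G (s + h) s - G s (s + h)) * h powr a\<bar> \<le> (2 * D * h) * h powr a"
        unfolding abs_mult using g by (intro mult_mono) auto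
      have t3: "r s s = 0" "r (s + h) (s + h) = 0" "\<bar>r (s + h) s\<bar> \<le> \<epsilon> / 4 * h powr a" "\<bar>r s (s + h)\<bar> \<le> \<epsilon> / 4 * h powr a"
        using \<delta>2(2)[of "s + h" s] \<delta>2(2)[of s "s + h"] h s remainder_term_diagonal[OF rt] by auto
      have "rect_increment K s (s + h) s (s + h) + 2 * G s s * h powr a =
         rect_increment (\<lambda>s t. G0 s t + G2 s t * \<bar>s - t\<bar> powr 2) s (s + h) s (s + h)
         + (2 * G s s - G (s + h) s - G s (s + h)) * h powr a - r (s + h) s - r s (s + h)"
        using e s h t3 by (simp add: rect_increment_def algebra_simps)
      moreover have "C * h powr 2 + 2 * D * h * h powr a \<le> \<epsilon> / 2 * h powr a"
      proof -
        have "C * h powr 2 + 2 * D * h * h powr a = (C * h powr (2 - a) + 2 * D * h) * h powr a"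
          using h by (simp add: algebra_simps flip: powr_add)
        also have "\<dots> \<le> \<epsilon> / 2 * h powr a" using elim by (intro mult_right_mono) auto
        finally show ?thesis .
      qed
      ultimately show "\<bar>rect_increment K s (s + h) s (s + h) + 2 * G s s * h powr a\<bar> \<le> \<epsilon> * h powr a"
        using t1 t2 t3 by linarith
    qed
  qed
qed

section \<open>Gaussian linear spaces\<close>

text \<open>A degenerate variable is almost surely constant, and the constant is 0 because the mean
  is; otherwise the moments are those of a centred normal density.\<close>

lemma (in prob_space) centred_gaussian_moments:
  assumes "gaussian_rv M V" "expectation V = 0"
  shows "integrable M (\<lambda>\<omega>. V \<omega> ^ k)" "expectation (\<lambda>\<omega>. V \<omega> ^ 4) = 3 * (expectation (\<lambda>\<omega>. (V \<omega>)\<^sup>2))\<^sup>2"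
proof -
  have [measurable]: "V \<in> borel_measurable M" using assms(1) by (simp add: gaussian_rv_def)
  obtain \<mu> \<sigma> where "(\<sigma> = 0 \<and> (AE \<omega> in M. V \<omega> = \<mu>)) \<or>
            (0 < \<sigma> \<and> distributed M lborel V (normal_density \<mu> \<sigma>))"
    using assms(1) unfolding gaussian_rv_def by auto
  then have "integrable M (\<lambda>\<omega>. V \<omega> ^ k) \<and> expectation (\<lambda>\<omega>. V \<omega> ^ 4) = 3 * (expectation (\<lambda>\<omega>. (V \<omega>)\<^sup>2))\<^sup>2"
  proof (elim disjE conjE)
    assume ae: "AE \<omega> in M. V \<omega> = \<mu>"
    have e: "expectation (\<lambda>\<omega>. V \<omega> ^ j) = \<mu> ^ j" for j
    proof -
      have "expectation (\<lambda>\<omega>. V \<omega> ^ j) = expectation (\<lambda>\<omega>. \<mu> ^ j)"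
        using ae by (intro integral_cong_AE) (auto elim!: eventually_mono)
      then show ?thesis by (simp add: prob_space)
    qed
    then have "\<mu> = 0" using assms(2) e[of 1] by simp
    moreover have "integrable M (\<lambda>\<omega>. V \<omega> ^ k) \<longleftrightarrow> integrable M (\<lambda>\<omega>. \<mu> ^ k)"
      using ae by (intro integrable_cong_AE) (auto elim!: eventually_mono)
    ultimately show ?thesis using e[of 4] e[of 2] by simp
  next
    assume \<sigma>: "0 < \<sigma>" and d: "distributed M lborel V (normal_density \<mu> \<sigma>)"
    note mom = distributed_integral[OF d, simplified] distributed_integrable[OF d, simplified]
    have "\<mu> = 0"
      using mom(1)[of "\<lambda>x. x"] integral_normal_moment_nz_1[OF \<sigma>, of \<mu>] assms(2) by simp
    then show ?thesis
      using mom(2)[of "\<lambda>x. x ^ k"] integrable_normal_moment[OF \<sigma>, of 0 k]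
        mom(1)[of "\<lambda>x. x ^ 4"] integral_normal_moment_even[OF \<sigma>, of 0 2]
        mom(1)[of "\<lambda>x. x ^ 2"] integral_normal_moment_even[OF \<sigma>, of 0 1]
      by (simp add: fact_numeral power2_eq_square field_simps)
  qed
  then show "integrable M (\<lambda>\<omega>. V \<omega> ^ k)" "expectation (\<lambda>\<omega>. V \<omega> ^ 4) = 3 * (expectation (\<lambda>\<omega>. (V \<omega>)\<^sup>2))\<^sup>2"
    by auto
qed

text \<open>A Gaussian Hilbert space without completeness. Closure under linear combinations allows
  mixed moments to be derived from moments of single variables by polarisation.\<close>

locale gaussian_linear_space = prob_space M for M :: "'a measure" +
  fixes H :: "('a \<Rightarrow> real) set"
  assumes add: "V \<in> H \<Longrightarrow> W \<in> H \<Longrightarrow> (\<lambda>\<omega>. V \<omega> + W \<omega>) \<in> H"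
    and scale: "V \<in> H \<Longrightarrow> (\<lambda>\<omega>. c * V \<omega>) \<in> H"
    and gaussian: "V \<in> H \<Longrightarrow> gaussian_rv M V"
    and mean_zero: "V \<in> H \<Longrightarrow> expectation V = 0"
begin

lemma diff: "V \<in> H \<Longrightarrow> W \<in> H \<Longrightarrow> (\<lambda>\<omega>. V \<omega> - W \<omega>) \<in> H"
  using add[OF _ scale[of W "-1"], of V] by simp

lemma measurable [measurable_dest]: "V \<in> H \<Longrightarrow> V \<in> borel_measurable M"
  using gaussian by (simp add: gaussian_rv_def)

lemmas moments = centred_gaussian_moments[OF gaussian mean_zero]

lemma integrable_product:
  assumes "V \<in> H" "W \<in> H"
  shows "integrable M (\<lambda>\<omega>. V \<omega> * W \<omega>)"
proof -
  have "integrable M (\<lambda>\<omega>. ((V \<omega> + W \<omega>) ^ 2 - (V \<omega> - W \<omega>) ^ 2) / 4)"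
    using moments(1)[OF add[OF assms] add[OF assms], of 2] moments(1)[OF diff[OF assms] diff[OF assms], of 2] by simp
  also have "(\<lambda>\<omega>. ((V \<omega> + W \<omega>) ^ 2 - (V \<omega> - W \<omega>) ^ 2) / 4) = (\<lambda>\<omega>. V \<omega> * W \<omega>)"
    by (simp add: fun_eq_iff power2_eq_square algebra_simps)
  finally show ?thesis .
qed

text \<open>The fourth moment of \<open>A + x * B + y * C + z * D\<close> is three times the square
  of its variance. Polarising both sides over the signs of \<open>x\<close>, \<open>y\<close>,
  \<open>z\<close> isolates the product on the left and the three pairings on the right. The sign of
  \<open>A\<close> can be fixed because fourth powers are even.\<close>

lemma isserlis:
  assumes H: "A \<in> H" "B \<in> H" "C \<in> H" "D \<in> H"
  shows "integrable M (\<lambda>\<omega>. A \<omega> * B \<omega> * C \<omega> * D \<omega>)"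
    "expectation (\<lambda>\<omega>. A \<omega> * B \<omega> * C \<omega> * D \<omega>) =
       expectation (\<lambda>\<omega>. A \<omega> * B \<omega>) * expectation (\<lambda>\<omega>. C \<omega> * D \<omega>) +
       expectation (\<lambda>\<omega>. A \<omega> * C \<omega>) * expectation (\<lambda>\<omega>. B \<omega> * D \<omega>) +
       expectation (\<lambda>\<omega>. A \<omega> * D \<omega>) * expectation (\<lambda>\<omega>. B \<omega> * C \<omega>)"
proof -
  define S where "S x y z = (\<lambda>\<omega>. A \<omega> + x * B \<omega> + y * C \<omega> + z * D \<omega>)" for x y z
  define Q where "Q x y z = expectation (\<lambda>\<omega>. (S x y z \<omega>)\<^sup>2)" for x y z
  have SH: "S x y z \<in> H" for x y z
    unfolding S_def by (intro add scale H)
  have iS: "integrable M (\<lambda>\<omega>. S x y z \<omega> ^ 4)" for x y z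
    by (rule moments(1)[OF SH SH])
  have eS: "expectation (\<lambda>\<omega>. S x y z \<omega> ^ 4) = 3 * (Q x y z)\<^sup>2" for x y z
    unfolding Q_def by (rule moments(2)[OF SH SH])
  note ip = integrable_product[OF H(1) H(1)] integrable_product[OF H(1) H(2)] integrable_product[OF H(1) H(3)]
    integrable_product[OF H(1) H(4)] integrable_product[OF H(2) H(2)] integrable_product[OF H(2) H(3)]
    integrable_product[OF H(2) H(4)] integrable_product[OF H(3) H(3)] integrable_product[OF H(3) H(4)]
    integrable_product[OF H(4) H(4)]
  let ?e = "\<lambda>V W. expectation (\<lambda>\<omega>. V \<omega> * W \<omega>)"
  have Q: "Q x y z = ?e A A + x\<^sup>2 * ?e B B + y\<^sup>2 * ?e C C + z\<^sup>2 * ?e D D + 2 * x * ?e A B + 2 * y * ?e A C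
      + 2 * z * ?e A D + 2 * x * y * ?e B C + 2 * x * z * ?e B D + 2 * y * z * ?e C D" for x y z
  proof -
    have "Q x y z = expectation (\<lambda>\<omega>. A \<omega> * A \<omega> + x\<^sup>2 * (B \<omega> * B \<omega>) + y\<^sup>2 * (C \<omega> * C \<omega>) + z\<^sup>2 * (D \<omega> * D \<omega>)
        + 2 * x * (A \<omega> * B \<omega>) + 2 * y * (A \<omega> * C \<omega>) + 2 * z * (A \<omega> * D \<omega>)
        + 2 * x * y * (B \<omega> * C \<omega>) + 2 * x * z * (B \<omega> * D \<omega>) + 2 * y * z * (C \<omega> * D \<omega>))"
      unfolding Q_def S_def by (intro Bochner_Integration.integral_cong) (simp_all add: power2_eq_square algebra_simps)
    then show ?thesis using ip by simp
  qed
  \<comment> \<open>Polarisation: the signed fourth powers add up to \<open>4! \<cdot> 2\<^sup>3 = 192\<close> times the product.\<close>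
  define P where "P = (\<lambda>\<omega>. (S 1 1 1 \<omega> ^ 4 - S 1 1 (-1) \<omega> ^ 4 - S 1 (-1) 1 \<omega> ^ 4 + S 1 (-1) (-1) \<omega> ^ 4
      - S (-1) 1 1 \<omega> ^ 4 + S (-1) 1 (-1) \<omega> ^ 4 + S (-1) (-1) 1 \<omega> ^ 4 - S (-1) (-1) (-1) \<omega> ^ 4) / 192)"
  have P: "P = (\<lambda>\<omega>. A \<omega> * B \<omega> * C \<omega> * D \<omega>)"
  proof
    fix \<omega>
    have "(a + b + c + d) ^ 4 - (a + b + c - d) ^ 4 - (a + b - c + d) ^ 4 + (a + b - c - d) ^ 4
      - (a - b + c + d) ^ 4 + (a - b + c - d) ^ 4 + (a - b - c + d) ^ 4 - (a - b - c - d) ^ 4 = 192 * (a * b * c * d)"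
      for a b c d :: real by algebra
    from this[of "A \<omega>" "B \<omega>" "C \<omega>" "D \<omega>"] show "P \<omega> = A \<omega> * B \<omega> * C \<omega> * D \<omega>"
      by (simp add: P_def S_def)
  qed
  show "integrable M (\<lambda>\<omega>. A \<omega> * B \<omega> * C \<omega> * D \<omega>)"
    unfolding P[symmetric] P_def
    by (intro integrable_divide Bochner_Integration.integrable_add Bochner_Integration.integrable_diff iS)
  have "expectation P = (3 * (Q 1 1 1)\<^sup>2 - 3 * (Q 1 1 (-1))\<^sup>2 - 3 * (Q 1 (-1) 1)\<^sup>2 + 3 * (Q 1 (-1) (-1))\<^sup>2
      - 3 * (Q (-1) 1 1)\<^sup>2 + 3 * (Q (-1) 1 (-1))\<^sup>2 + 3 * (Q (-1) (-1) 1)\<^sup>2 - 3 * (Q (-1) (-1) (-1))\<^sup>2) / 192"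
    unfolding P_def using iS by (simp add: eS)
  also have "\<dots> = ?e A B * ?e C D + ?e A C * ?e B D + ?e A D * ?e B C"
    unfolding Q by (simp add: field_simps power2_eq_square)
  finally show "expectation (\<lambda>\<omega>. A \<omega> * B \<omega> * C \<omega> * D \<omega>) =
       expectation (\<lambda>\<omega>. A \<omega> * B \<omega>) * expectation (\<lambda>\<omega>. C \<omega> * D \<omega>) +
       expectation (\<lambda>\<omega>. A \<omega> * C \<omega>) * expectation (\<lambda>\<omega>. B \<omega> * D \<omega>) +
       expectation (\<lambda>\<omega>. A \<omega> * D \<omega>) * expectation (\<lambda>\<omega>. B \<omega> * C \<omega>)"
    unfolding P .
qed

text \<open>Centring cancels the pairing of \<open>A\<close> with \<open>B\<close> and
  \<open>C\<close> with \<open>D\<close> in the formula of Isserlis; the other two remain.\<close>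

lemma covariance_of_products:
  assumes H: "A \<in> H" "B \<in> H" "C \<in> H" "D \<in> H"
  defines "U \<equiv> \<lambda>\<omega>. A \<omega> * B \<omega> - expectation (\<lambda>\<omega>. A \<omega> * B \<omega>)"
    and "V \<equiv> \<lambda>\<omega>. C \<omega> * D \<omega> - expectation (\<lambda>\<omega>. C \<omega> * D \<omega>)"
  shows "integrable M (\<lambda>\<omega>. U \<omega> * V \<omega>)"
    "expectation (\<lambda>\<omega>. U \<omega> * V \<omega>) =
       expectation (\<lambda>\<omega>. A \<omega> * C \<omega>) * expectation (\<lambda>\<omega>. B \<omega> * D \<omega>) +
       expectation (\<lambda>\<omega>. A \<omega> * D \<omega>) * expectation (\<lambda>\<omega>. B \<omega> * C \<omega>)"
proof -
  define a where "a = expectation (\<lambda>\<omega>. A \<omega> * B \<omega>)"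
  define c where "c = expectation (\<lambda>\<omega>. C \<omega> * D \<omega>)"
  have eq: "(\<lambda>\<omega>. U \<omega> * V \<omega>) = (\<lambda>\<omega>. A \<omega> * B \<omega> * C \<omega> * D \<omega> - c * (A \<omega> * B \<omega>) - a * (C \<omega> * D \<omega>) + a * c)"
    unfolding U_def V_def a_def[symmetric] c_def[symmetric] by (simp add: fun_eq_iff algebra_simps)
  note i = isserlis(1)[OF H] integrable_product[OF H(1,2)] integrable_product[OF H(3,4)]
  show "integrable M (\<lambda>\<omega>. U \<omega> * V \<omega>)"
    unfolding eq using i by simp
  show "expectation (\<lambda>\<omega>. U \<omega> * V \<omega>) =
       expectation (\<lambda>\<omega>. A \<omega> * C \<omega>) * expectation (\<lambda>\<omega>. B \<omega> * D \<omega>) +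
       expectation (\<lambda>\<omega>. A \<omega> * D \<omega>) * expectation (\<lambda>\<omega>. B \<omega> * C \<omega>)"
    unfolding eq using i isserlis(2)[OF H] by (simp add: a_def[symmetric] c_def[symmetric] prob_space)
qed

text \<open>\<open>g\<close> assigns the indices to \<open>m\<close> blocks. The square of the sum
  of the block sums is estimated pointwise, before expectations are taken, so no covariance between
  different blocks appears.\<close>

lemma blockwise_variance_bound:
  fixes A B :: "nat \<Rightarrow> 'a \<Rightarrow> real"
  assumes "finite I" "\<And>i. i \<in> I \<Longrightarrow> A i \<in> H" "\<And>i. i \<in> I \<Longrightarrow> B i \<in> H" "g ` I \<subseteq> {..<m}"
  defines "T \<equiv> \<lambda>\<omega>. \<Sum>i\<in>I. A i \<omega> * B i \<omega>"
  shows "integrable M (\<lambda>\<omega>. (T \<omega> - expectation T)\<^sup>2)"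
    "variance T \<le> real m * (\<Sum>i\<in>I. \<Sum>j\<in>{j \<in> I. g j = g i}.
        \<bar>expectation (\<lambda>\<omega>. A i \<omega> * A j \<omega>)\<bar> * \<bar>expectation (\<lambda>\<omega>. B i \<omega> * B j \<omega>)\<bar> +
        \<bar>expectation (\<lambda>\<omega>. A i \<omega> * B j \<omega>)\<bar> * \<bar>expectation (\<lambda>\<omega>. B i \<omega> * A j \<omega>)\<bar>)"
proof -
  define V where "V i = (\<lambda>\<omega>. A i \<omega> * B i \<omega> - expectation (\<lambda>\<omega>. A i \<omega> * B i \<omega>))" for i
  have cov: "integrable M (\<lambda>\<omega>. V i \<omega> * V j \<omega>)"
    "expectation (\<lambda>\<omega>. V i \<omega> * V j \<omega>) =
       expectation (\<lambda>\<omega>. A i \<omega> * A j \<omega>) * expectation (\<lambda>\<omega>. B i \<omega> * B j \<omega>) +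
       expectation (\<lambda>\<omega>. A i \<omega> * B j \<omega>) * expectation (\<lambda>\<omega>. B i \<omega> * A j \<omega>)"
    if "i \<in> I" "j \<in> I" for i j
    using covariance_of_products[of "A i" "B i" "A j" "B j"] assms(2,3) that by (simp_all add: V_def)
  have "expectation T = (\<Sum>i\<in>I. expectation (\<lambda>\<omega>. A i \<omega> * B i \<omega>))"
    unfolding T_def using assms(2,3) by (intro Bochner_Integration.integral_sum integrable_product)
  then have T: "T \<omega> - expectation T = (\<Sum>i\<in>I. V i \<omega>)" for \<omega>
    by (simp add: T_def V_def sum_subtractf)
  show "integrable M (\<lambda>\<omega>. (T \<omega> - expectation T)\<^sup>2)"
    unfolding T power2_eq_square sum_product by (intro Bochner_Integration.integrable_sum cov)
  then have "variance T \<le> expectation (\<lambda>\<omega>. real m * (\<Sum>i\<in>I. \<Sum>j\<in>{j \<in> I. g j = g i}. V i \<omega> * V j \<omega>))"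
  proof (rule integral_mono)
    show "integrable M (\<lambda>\<omega>. real m * (\<Sum>i\<in>I. \<Sum>j\<in>{j \<in> I. g j = g i}. V i \<omega> * V j \<omega>))"
      by (intro integrable_mult_right Bochner_Integration.integrable_sum cov) auto
    fix \<omega>
    have "(\<Sum>i\<in>I. V i \<omega>) = (\<Sum>b<m. \<Sum>i\<in>{i\<in>I. g i = b}. V i \<omega>)"
      using assms(1,4) by (intro sum.group[symmetric]) auto
    then have "(T \<omega> - expectation T)\<^sup>2 \<le> (\<Sum>b<m. (\<Sum>i\<in>{i\<in>I. g i = b}. V i \<omega>)\<^sup>2) * real m"
      unfolding T using sum_squared_le_sum_of_squares[of "\<lambda>b. \<Sum>i\<in>{i\<in>I. g i = b}. V i \<omega>" "{..<m}"] by simp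
    also have "(\<Sum>b<m. (\<Sum>i\<in>{i\<in>I. g i = b}. V i \<omega>)\<^sup>2) =
        (\<Sum>b<m. \<Sum>i\<in>{i\<in>I. g i = b}. \<Sum>j\<in>{j \<in> I. g j = g i}. V i \<omega> * V j \<omega>)"
      unfolding power2_eq_square sum_product by (intro sum.cong refl) auto
    also have "\<dots> = (\<Sum>i\<in>I. \<Sum>j\<in>{j \<in> I. g j = g i}. V i \<omega> * V j \<omega>)"
      using assms(1,4) by (intro sum.group) auto
    finally show "(T \<omega> - expectation T)\<^sup>2 \<le> real m * (\<Sum>i\<in>I. \<Sum>j\<in>{j \<in> I. g j = g i}. V i \<omega> * V j \<omega>)"
      by (simp add: mult.commute)
  qed
  also have "\<dots> = real m * (\<Sum>i\<in>I. \<Sum>j\<in>{j \<in> I. g j = g i}. expectation (\<lambda>\<omega>. V i \<omega> * V j \<omega>))"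
  proof -
    have "expectation (\<lambda>\<omega>. \<Sum>j\<in>{j \<in> I. g j = g i}. V i \<omega> * V j \<omega>) =
        (\<Sum>j\<in>{j \<in> I. g j = g i}. expectation (\<lambda>\<omega>. V i \<omega> * V j \<omega>))" if "i \<in> I" for i
      using that by (intro Bochner_Integration.integral_sum cov) auto
    moreover have "expectation (\<lambda>\<omega>. \<Sum>i\<in>I. \<Sum>j\<in>{j \<in> I. g j = g i}. V i \<omega> * V j \<omega>) =
        (\<Sum>i\<in>I. expectation (\<lambda>\<omega>. \<Sum>j\<in>{j \<in> I. g j = g i}. V i \<omega> * V j \<omega>))"
      by (intro Bochner_Integration.integral_sum Bochner_Integration.integrable_sum cov) auto
    ultimately show ?thesis by simp
  qed
  also have "\<dots> \<le> real m * (\<Sum>i\<in>I. \<Sum>j\<in>{j \<in> I. g j = g i}.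
        \<bar>expectation (\<lambda>\<omega>. A i \<omega> * A j \<omega>)\<bar> * \<bar>expectation (\<lambda>\<omega>. B i \<omega> * B j \<omega>)\<bar> +
        \<bar>expectation (\<lambda>\<omega>. A i \<omega> * B j \<omega>)\<bar> * \<bar>expectation (\<lambda>\<omega>. B i \<omega> * A j \<omega>)\<bar>)"
  proof (intro mult_left_mono sum_mono)
    fix i j assume "i \<in> I" "j \<in> {j \<in> I. g j = g i}"
    then show "expectation (\<lambda>\<omega>. V i \<omega> * V j \<omega>) \<le>
        \<bar>expectation (\<lambda>\<omega>. A i \<omega> * A j \<omega>)\<bar> * \<bar>expectation (\<lambda>\<omega>. B i \<omega> * B j \<omega>)\<bar> +
        \<bar>expectation (\<lambda>\<omega>. A i \<omega> * B j \<omega>)\<bar> * \<bar>expectation (\<lambda>\<omega>. B i \<omega> * A j \<omega>)\<bar>"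
      by (simp add: cov(2) abs_mult[symmetric] add_mono)
  qed simp
  finally show "variance T \<le> real m * (\<Sum>i\<in>I. \<Sum>j\<in>{j \<in> I. g j = g i}.
        \<bar>expectation (\<lambda>\<omega>. A i \<omega> * A j \<omega>)\<bar> * \<bar>expectation (\<lambda>\<omega>. B i \<omega> * B j \<omega>)\<bar> +
        \<bar>expectation (\<lambda>\<omega>. A i \<omega> * B j \<omega>)\<bar> * \<bar>expectation (\<lambda>\<omega>. B i \<omega> * A j \<omega>)\<bar>)" .
qed

end

section \<open>The linear span of a Gaussian field\<close>

definition finite_combinations :: "'i set \<Rightarrow> 't set \<Rightarrow> ('i \<Rightarrow> 't \<Rightarrow> 'a \<Rightarrow> real) \<Rightarrow> ('a \<Rightarrow> real) set" where
  "finite_combinations I T Z =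
     {V. \<exists>F c. finite F \<and> F \<subseteq> I \<times> T \<and> V = (\<lambda>\<omega>. \<Sum>(k, s)\<in>F. c k s * Z k s \<omega>)}"

lemma finite_combinations_base:
  assumes "k \<in> I" "s \<in> T"
  shows "Z k s \<in> finite_combinations I T Z"
  unfolding finite_combinations_def
  by (rule CollectI, rule exI[of _ "{(k, s)}"], rule exI[of _ "\<lambda>_ _. 1"]) (use assms in auto)

lemma zero_mean_gaussian_field_linear_space:
  assumes "zero_mean_gaussian_field M I T Z K"
  shows "gaussian_linear_space M (finite_combinations I T Z)"
proof -
  have p: "prob_space M" and g: "\<And>F c. finite F \<Longrightarrow> F \<subseteq> I \<times> T \<Longrightarrow> gaussian_rv M (\<lambda>\<omega>. \<Sum>(k, s)\<in>F. c k s * Z k s \<omega>)"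
    and m: "\<And>k s. k \<in> I \<Longrightarrow> s \<in> T \<Longrightarrow> integral\<^sup>L M (Z k s) = 0"
    using assms unfolding zero_mean_gaussian_field_def by blast+
  interpret prob_space M by fact
  let ?H = "finite_combinations I T Z"
  have gH: "gaussian_rv M V" if "V \<in> ?H" for V
    using that g unfolding finite_combinations_def by blast
  have int: "integrable M (Z k s)" if "k \<in> I" "s \<in> T" for k s
    using centred_gaussian_moments(1)[OF gH[OF finite_combinations_base[OF that]] m[OF that], of 1] by simp
  show ?thesis
  proof
    fix V W assume "V \<in> ?H" "W \<in> ?H"
    then obtain F c F' c' where F: "finite F" "F \<subseteq> I \<times> T" "V = (\<lambda>\<omega>. \<Sum>(k, s)\<in>F. c k s * Z k s \<omega>)"
      and F': "finite F'" "F' \<subseteq> I \<times> T" "W = (\<lambda>\<omega>. \<Sum>(k, s)\<in>F'. c' k s * Z k s \<omega>)"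
      unfolding finite_combinations_def by blast
    \<comment> \<open>Both coefficient families are extended by zero to
      \<open>F \<union> F'\<close>, since the supports may overlap.\<close>
    let ?c = "\<lambda>k s. (if (k, s) \<in> F then c k s else 0) + (if (k, s) \<in> F' then c' k s else 0)"
    have "V \<omega> + W \<omega> = (\<Sum>(k, s)\<in>F \<union> F'. ?c k s * Z k s \<omega>)" for \<omega>
    proof -
      have "V \<omega> = (\<Sum>(k, s)\<in>F \<union> F'. (if (k, s) \<in> F then c k s else 0) * Z k s \<omega>)"
        unfolding F(3) using F(1) F'(1) by (intro sum.mono_neutral_cong_left) auto
      moreover have "W \<omega> = (\<Sum>(k, s)\<in>F \<union> F'. (if (k, s) \<in> F' then c' k s else 0) * Z k s \<omega>)"
        unfolding F'(3) using F(1) F'(1) by (intro sum.mono_neutral_cong_left) auto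
      ultimately show ?thesis
        by (simp add: sum.distrib[symmetric] distrib_right case_prod_unfold)
    qed
    then show "(\<lambda>\<omega>. V \<omega> + W \<omega>) \<in> ?H"
      unfolding finite_combinations_def using F(1,2) F'(1,2)
      by (intro CollectI exI[of _ "F \<union> F'"] exI[of _ ?c]) auto
  next
    fix V c assume "V \<in> ?H"
    then obtain F c' where F: "finite F" "F \<subseteq> I \<times> T" "V = (\<lambda>\<omega>. \<Sum>(k, s)\<in>F. c' k s * Z k s \<omega>)"
      unfolding finite_combinations_def by blast
    show "(\<lambda>\<omega>. c * V \<omega>) \<in> ?H"
      unfolding finite_combinations_def F(3) using F(1,2)
      by (intro CollectI exI[of _ F] exI[of _ "\<lambda>k s. c * c' k s"])
         (auto simp: sum_distrib_left mult.assoc case_prod_unfold)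
  next
    fix V assume "V \<in> ?H"
    then obtain F c where F: "finite F" "F \<subseteq> I \<times> T" "V = (\<lambda>\<omega>. \<Sum>(k, s)\<in>F. c k s * Z k s \<omega>)"
      unfolding finite_combinations_def by blast
    have "expectation V = (\<Sum>x\<in>F. expectation (\<lambda>\<omega>. c (fst x) (snd x) * Z (fst x) (snd x) \<omega>))"
      unfolding F(3) case_prod_unfold using F(2) int by (intro Bochner_Integration.integral_sum) auto
    also have "\<dots> = 0" using F(2) m by (intro sum.neutral) auto
    finally show "expectation V = 0" .
  qed (fact gH)
qed

section \<open>Increments along a mesh\<close>

text \<open>On natural numbers \<open>i - j + (j - i)\<close> is the distance of \<open>i\<close> and \<open>j\<close>, by truncated subtraction.\<close>
lemma toeplitz_sum_bound:
  fixes f :: "nat \<Rightarrow> real"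
  assumes "summable f" "\<And>k. 0 \<le> f k"
  shows "(\<Sum>i=1..n. \<Sum>j=1..n. f (i - j + (j - i))) \<le> 2 * suminf f * real n"
proof -
  have sub: "(\<Sum>j\<in>J. f (g j)) \<le> suminf f" if "finite J" "inj_on g J" for J :: "nat set" and g
    using sum_le_suminf[OF assms(1), of "g ` J"] assms(2) that by (simp add: sum.reindex)
  have "(\<Sum>j=1..n. f (i - j + (j - i))) \<le> 2 * suminf f" for i
  proof -
    \<comment> \<open>Splitting at \<open>i\<close> makes the distance injective in \<open>j\<close>
      on each half, so each half is bounded by the full series.\<close>
    have "(\<Sum>j=1..n. f (i - j + (j - i))) = (\<Sum>j\<in>{j\<in>{1..n}. j \<le> i}. f (i - j + (j - i))) + (\<Sum>j\<in>{j\<in>{1..n}. \<not> j \<le> i}. f (i - j + (j - i)))"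
      by (subst sum.union_disjoint[symmetric]) (auto intro!: sum.cong)
    also have "\<dots> \<le> suminf f + suminf f"
      by (intro add_mono sub) (auto simp: inj_on_def)
    finally show ?thesis by simp
  qed
  then have "(\<Sum>i=1..n. \<Sum>j=1..n. f (i - j + (j - i))) \<le> (\<Sum>i=1..n. 2 * suminf f)"
    by (intro sum_mono)
  then show ?thesis by (simp add: mult.commute)
qed

text \<open>Equal quotients by \<open>n + 1\<close> cancel, so \<open>i * m\<close> and
  \<open>j * m\<close> differ only by their remainders, that is by at most \<open>n\<close>. Indices
  in the same block are thus at most \<open>n / m\<close> apart.\<close>

lemma same_block_close:
  fixes i j m n :: nat
  assumes "i * m div (n + 1) = j * m div (n + 1)"
  shows "(i - j + (j - i)) * m \<le> n"
proof -
  have *: "(u - v) * m \<le> n" if "u * m div (n + 1) = v * m div (n + 1)" for u v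
  proof -
    have "u * m = (v * m div (n + 1)) * (n + 1) + u * m mod (n + 1)"
      unfolding that[symmetric] by (simp only: div_mult_mod_eq)
    also have "\<dots> \<le> v * m + n"
      by (intro add_mono div_times_less_eq_dividend) (use mod_less_divisor[of "n + 1" "u * m"] in linarith)
    finally show ?thesis by (simp add: diff_mult_distrib)
  qed
  show ?thesis
    using *[OF assms] *[OF assms[symmetric]] by (cases "i \<le> j") auto
qed

lemma tendsto_mesh_at_right:
  assumes "0 < L"
  shows "filterlim (\<lambda>n. L / real n) (at_right 0) sequentially"
  using assms by real_asymp

lemma mesh_point:
  fixes L :: real
  assumes "0 < L" "i \<in> {1..n}"
  shows "(real i - 1) * (L / real n) \<in> {0..L}" "real i * (L / real n) \<in> {0..L}"
    "real i * (L / real n) = (real i - 1) * (L / real n) + L / real n"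
proof -
  have i: "1 \<le> real i" "real i \<le> real n" using assms(2) by auto
  then have "0 < real n" by linarith
  then have h: "0 < L / real n" using assms(1) by simp
  have "real i * (L / real n) \<le> real n * (L / real n)" using i h by (intro mult_right_mono) auto
  also have "\<dots> = L" using \<open>0 < real n\<close> by simp
  finally have a: "real i * (L / real n) \<le> L" .
  show e: "real i * (L / real n) = (real i - 1) * (L / real n) + L / real n" by (simp add: left_diff_distrib diff_divide_distrib)
  have "0 \<le> (real i - 1) * (L / real n)" using i h by (intro mult_nonneg_nonneg) auto
  with a e h show "real i * (L / real n) \<in> {0..L}" "(real i - 1) * (L / real n) \<in> {0..L}"
    unfolding atLeastAtMost_iff by linarith+
qed

abbreviation mesh_increment :: "real \<Rightarrow> (real \<Rightarrow> 'a \<Rightarrow> real) \<Rightarrow> nat \<Rightarrow> nat \<Rightarrow> 'a \<Rightarrow> real" where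
  "mesh_increment L A n i \<omega> \<equiv> A (real i * (L / real n)) \<omega> - A ((real i - 1) * (L / real n)) \<omega>"

abbreviation mesh_rect :: "real \<Rightarrow> (real \<Rightarrow> real \<Rightarrow> real) \<Rightarrow> nat \<Rightarrow> nat \<Rightarrow> nat \<Rightarrow> real" where
  "mesh_rect L K n i j \<equiv> rect_increment K ((real i - 1) * (L / real n)) (real i * (L / real n))
     ((real j - 1) * (L / real n)) (real j * (L / real n))"

lemma cell_bounded_mesh:
  assumes "cell_bounded L p K" "0 < L"
  obtains C \<delta> where "0 \<le> C" "0 < \<delta>"
    "\<And>n i j. L / real n < \<delta> \<Longrightarrow> i \<in> {1..n} \<Longrightarrow> j \<in> {1..n} \<Longrightarrow> real (i - j + (j - i)) * (L / real n) < \<delta> \<Longrightarrow>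
       \<bar>mesh_rect L K n i j\<bar> \<le> C * ((L / real n) powr p * max 1 (real (i - j + (j - i))) powr (p - 2))"
proof -
  obtain C \<delta> where C: "0 \<le> C" "0 < \<delta>"
    "\<And>h s t k. 0 < h \<Longrightarrow> h < \<delta> \<Longrightarrow> real k * h < \<delta> \<Longrightarrow> s \<in> {0..L} \<Longrightarrow> s + h \<in> {0..L} \<Longrightarrow> t \<in> {0..L} \<Longrightarrow> t + h \<in> {0..L} \<Longrightarrow>
      \<bar>s - t\<bar> = real k * h \<Longrightarrow>
      \<bar>rect_increment K s (s + h) t (t + h)\<bar> \<le> C * (h powr p * max 1 (real k) powr (p - 2))"
    using cell_boundedE[OF assms(1)] by metis
  show ?thesis
  proof (rule that[OF C(1,2)])
    fix n i j :: nat assume *: "L / real n < \<delta>" "i \<in> {1..n}" "j \<in> {1..n}" "real (i - j + (j - i)) * (L / real n) < \<delta>"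
    have h: "0 < L / real n" using assms(2) *(2) by auto
    note pi = mesh_point[OF assms(2) *(2)] and pj = mesh_point[OF assms(2) *(3)]
    have "(real i - 1) * (L / real n) - (real j - 1) * (L / real n) = (real i - real j) * (L / real n)"
      by (simp add: left_diff_distrib diff_divide_distrib)
    moreover have "\<bar>real i - real j\<bar> = real (i - j + (j - i))"
      by (cases "i \<le> j") (auto simp: of_nat_diff)
    ultimately have d: "\<bar>(real i - 1) * (L / real n) - (real j - 1) * (L / real n)\<bar> = real (i - j + (j - i)) * (L / real n)"
      using h by (simp only: abs_mult abs_of_pos)
    show "\<bar>mesh_rect L K n i j\<bar> \<le> C * ((L / real n) powr p * max 1 (real (i - j + (j - i))) powr (p - 2))"
      using C(3)[OF h *(1,4) pi(1) _ pj(1) _ d, folded pi(3) pj(3)] pi(2) pj(2) by blast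
  qed
qed

section \<open>Riemann sums and the means of the increment sums\<close>

lemma riemann_sum_tendsto:
  fixes g :: "real \<Rightarrow> real"
  assumes "continuous_on {0..L} g" "0 < L"
  shows "(\<lambda>n. L / real n * (\<Sum>i=1..n. g ((real i - 1) * (L / real n)))) \<longlonglongrightarrow> integral {0..L} g"
proof (rule LIMSEQ_I)
  fix \<epsilon> :: real assume "0 < \<epsilon>"
  \<comment> \<open>Each cell contributes an error of at most \<open>\<eta> * h\<close>, and the
    \<open>n\<close> cells together \<open>\<eta> * L = \<epsilon> / 2\<close>.\<close>
  define \<eta> where "\<eta> = \<epsilon> / (2 * L)"
  have \<eta>: "0 < \<eta>" using \<open>0 < \<epsilon>\<close> assms(2) by (simp add: \<eta>_def)
  have "uniformly_continuous_on {0..L} g" by (rule compact_uniformly_continuous[OF assms(1)]) simp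
  then obtain \<delta> where \<delta>: "0 < \<delta>" "\<And>x y. x \<in> {0..L} \<Longrightarrow> y \<in> {0..L} \<Longrightarrow> dist y x < \<delta> \<Longrightarrow> dist (g y) (g x) < \<eta>"
    unfolding uniformly_continuous_on_def using \<eta> by metis
  have gi: "g integrable_on {u..v}" if "{u..v} \<subseteq> {0..L}" for u v
    using continuous_on_subset[OF assms(1) that] by (rule integrable_continuous_real)
  have "eventually (\<lambda>n. L / real n < \<delta> \<and> 0 < n) sequentially"
    using order_tendstoD(2)[OF lim_const_over_n[of L] \<delta>(1)] eventually_gt_at_top[of 0] by eventually_elim simp
  then obtain N where N: "\<And>n. n \<ge> N \<Longrightarrow> L / real n < \<delta> \<and> 0 < n" by (auto simp: eventually_at_top_linorder)
  show "\<exists>N. \<forall>n\<ge>N. norm (L / real n * (\<Sum>i=1..n. g ((real i - 1) * (L / real n))) - integral {0..L} g) < \<epsilon>"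
  proof (intro exI allI impI)
    fix n assume "n \<ge> N"
    define h where "h = L / real n"
    have h: "0 < h" "h < \<delta>" "real n * h = L" and n: "0 < n" using N[OF \<open>n \<ge> N\<close>] assms(2) by (auto simp: h_def)
    have cell: "\<bar>h * g ((real i - 1) * h) - integral {(real i - 1) * h..real i * h} g\<bar> \<le> \<eta> * h" if "i \<in> {1..n}" for i
    proof -
      note p = mesh_point[OF assms(2) that, folded h_def]
      have "((\<lambda>x. g ((real i - 1) * h) - g x) has_integral
          (h * g ((real i - 1) * h) - integral {(real i - 1) * h..real i * h} g)) {(real i - 1) * h..real i * h}"
        using has_integral_diff[OF has_integral_const_real[of "g ((real i - 1) * h)" "(real i - 1) * h" "real i * h"]
            integrable_integral[OF gi[of "(real i - 1) * h" "real i * h"]]] p h by simp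
      from has_integral_bound_real[OF _ finite.emptyI this, of \<eta>]
      have "norm (h * g ((real i - 1) * h) - integral {(real i - 1) * h..real i * h} g)
         \<le> \<eta> * measure lborel {(real i - 1) * h..real i * h}"
        using \<delta>(2) p h \<eta> by (force simp: dist_real_def abs_minus_commute less_imp_le)
      then show ?thesis using p(3) h by simp
    qed
    have split: "integral {0..real m * h} g = (\<Sum>i=1..m. integral {(real i - 1) * h..real i * h} g)" if "m \<le> n" for m
      using that
    proof (induction m)
      case (Suc m)
      have "real (Suc m) * h \<le> real n * h" using Suc.prems h by (intro mult_right_mono) auto
      then have "g integrable_on {0..real (Suc m) * h}" using h by (intro gi) auto
      then have "integral {0..real m * h} g + integral {real m * h..real (Suc m) * h} g = integral {0..real (Suc m) * h} g"
        using h by (intro Henstock_Kurzweil_Integration.integral_combine) (auto simp: distrib_right)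
      then show ?case using Suc by simp
    qed simp
    have "L / real n * (\<Sum>i=1..n. g ((real i - 1) * (L / real n))) - integral {0..L} g
       = (\<Sum>i=1..n. h * g ((real i - 1) * h) - integral {(real i - 1) * h..real i * h} g)"
      using split[of n] h(3) by (simp add: h_def[symmetric] sum_subtractf sum_distrib_left)
    also have "\<bar>\<dots>\<bar> \<le> (\<Sum>i=1..n. \<eta> * h)"
      by (rule order_trans[OF sum_abs sum_mono]) (rule cell)
    also have "\<dots> = \<epsilon> / 2" using h(3) assms(2) by (simp add: \<eta>_def mult.left_commute)
    also have "\<dots> < \<epsilon>" using \<open>0 < \<epsilon>\<close> by simp
    finally show "norm (L / real n * (\<Sum>i=1..n. g ((real i - 1) * (L / real n))) - integral {0..L} g) < \<epsilon>" by simp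
  qed
qed

lemma analytic_diagonal_continuous:
  assumes "real_analytic2_on G ({0..L} \<times> {0..L})" "0 < L"
  shows "continuous_on {0..L} (\<lambda>s. G s s)"
proof (rule continuous_onI)
  fix s \<epsilon> :: real assume s: "s \<in> {0..L}" and "0 < \<epsilon>"
  obtain C \<delta> where C: "0 < \<delta>" "\<And>a. a \<in> {0..L} \<Longrightarrow> bi_lipschitz_on ({0..L} \<inter> ball a \<delta>) C G"
    using real_analytic2_on_bi_lipschitz[OF assms] by blast
  have C0: "0 \<le> C" using C(2)[OF s] by (simp add: bi_lipschitz_on_def)
  \<comment> \<open>The passage from \<open>(s, s)\<close> to \<open>(t, t)\<close> takes two
    Lipschitz steps via \<open>(s, t)\<close>; the added 1 avoids division by 0 if
    \<open>C = 0\<close>.\<close>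
  show "\<exists>d>0. \<forall>t\<in>{0..L}. dist t s < d \<longrightarrow> dist (G t t) (G s s) \<le> \<epsilon>"
  proof (intro exI[of _ "min \<delta> (\<epsilon> / (2 * C + 1))"] conjI ballI impI)
    show "0 < min \<delta> (\<epsilon> / (2 * C + 1))" using C C0 \<open>0 < \<epsilon>\<close> by simp
    fix t assume t: "t \<in> {0..L}" "dist t s < min \<delta> (\<epsilon> / (2 * C + 1))"
    have m: "s \<in> {0..L} \<inter> ball s \<delta>" "t \<in> {0..L} \<inter> ball s \<delta>" using s t C(1) by (auto simp: dist_commute)
    have "\<bar>G t t - G s t\<bar> \<le> C * \<bar>s - t\<bar>" "\<bar>G s t - G s s\<bar> \<le> C * \<bar>s - t\<bar>"
      using bi_lipschitz_onD(2)[OF C(2)[OF s] m(2,1,2,2)] bi_lipschitz_onD(3)[OF C(2)[OF s] m(1,1,2,1)] by auto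
    then have "\<bar>G t t - G s s\<bar> \<le> (2 * C) * \<bar>s - t\<bar>" by linarith
    also have "\<dots> \<le> (2 * C + 1) * (\<epsilon> / (2 * C + 1))"
      using t(2) C0 by (intro mult_mono) (auto simp: dist_real_def abs_minus_commute)
    finally show "dist (G t t) (G s s) \<le> \<epsilon>" using C0 by (simp add: dist_real_def)
  qed
qed

text \<open>Each diagonal cell is \<open>- 2 * G s s * h powr a\<close> up to a small multiple of
  \<open>h powr a\<close>, uniformly in \<open>s\<close>. Dividing by \<open>h powr (a - 1)\<close>
  leaves a factor \<open>h\<close>, which turns the main part into a Riemann sum and keeps the total
  error small because \<open>n * h = L\<close>.\<close>

lemma sum_diagonal_rect_asymptotics:
  assumes "has_expansion L a K G0 G2 G r" "0 < L" "a < 2"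
  shows "(\<lambda>n. (\<Sum>i=1..n. mesh_rect L K n i i) / (L / real n) powr (a - 1)) \<longlonglongrightarrow> - 2 * integral {0..L} (\<lambda>s. G s s)"
proof -
  define R where "R n = - 2 * (L / real n * (\<Sum>i=1..n. G ((real i - 1) * (L / real n)) ((real i - 1) * (L / real n))))" for n
  have an: "real_analytic2_on G ({0..L} \<times> {0..L})" using assms(1) by (simp add: has_expansion_def)
  have R: "R \<longlonglongrightarrow> - 2 * integral {0..L} (\<lambda>s. G s s)"
    unfolding R_def
    by (intro tendsto_mult_left riemann_sum_tendsto[OF analytic_diagonal_continuous[OF an assms(2)] assms(2)])
  have "(\<lambda>n. (\<Sum>i=1..n. mesh_rect L K n i i) / (L / real n) powr (a - 1) - R n) \<longlonglongrightarrow> 0"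
  proof (rule tendstoI)
    fix \<epsilon> :: real assume "0 < \<epsilon>"
    define \<eta> where "\<eta> = \<epsilon> / (2 * L)"
    have \<eta>: "0 < \<eta>" using \<open>0 < \<epsilon>\<close> assms(2) by (simp add: \<eta>_def)
    have "\<forall>\<^sub>F n in sequentially. \<forall>s. s \<in> {0..L} \<longrightarrow> s + L / real n \<in> {0..L} \<longrightarrow>
      \<bar>rect_increment K s (s + L / real n) s (s + L / real n) + 2 * G s s * (L / real n) powr a\<bar> \<le> \<eta> * (L / real n) powr a"
      using has_expansion_diagonal_increment[OF assms \<eta>] tendsto_mesh_at_right[OF assms(2)]
      by (rule eventually_compose_filterlim)
    then show "\<forall>\<^sub>F n in sequentially. dist ((\<Sum>i=1..n. mesh_rect L K n i i) / (L / real n) powr (a - 1) - R n) 0 < \<epsilon>"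
      using eventually_gt_at_top[of 0]
    proof eventually_elim
      case (elim n)
      define h where "h = L / real n"
      have h: "0 < h" "real n * h = L" using elim assms(2) by (auto simp: h_def)
      have c: "\<bar>mesh_rect L K n i i + 2 * G ((real i - 1) * h) ((real i - 1) * h) * h powr a\<bar> \<le> \<eta> * h powr a"
        if "i \<in> {1..n}" for i
        using elim(1)[rule_format, of "(real i - 1) * (L / real n)"] mesh_point[OF assms(2) that] by (simp add: h_def)
      define w where "w = h powr (a - 1)"
      have w: "0 < w" and ha: "h powr a = h * w" using h by (simp_all add: w_def powr_diff)
      have "(\<Sum>i=1..n. mesh_rect L K n i i + 2 * G ((real i - 1) * h) ((real i - 1) * h) * h powr a) =
          (\<Sum>i=1..n. mesh_rect L K n i i) - w * R n"
        unfolding ha by (simp add: R_def h_def[symmetric] sum.distrib sum_distrib_left sum_negf mult_ac)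
      then have eq: "(\<Sum>i=1..n. mesh_rect L K n i i) / w - R n =
        (\<Sum>i=1..n. mesh_rect L K n i i + 2 * G ((real i - 1) * h) ((real i - 1) * h) * h powr a) / w"
        using w by (simp add: field_simps)
      have "\<bar>\<Sum>i=1..n. mesh_rect L K n i i + 2 * G ((real i - 1) * h) ((real i - 1) * h) * h powr a\<bar> \<le> (\<Sum>i=1..n. \<eta> * h powr a)"
        by (rule order_trans[OF sum_abs sum_mono]) (rule c)
      then have "\<bar>(\<Sum>i=1..n. mesh_rect L K n i i) / w - R n\<bar> \<le> (\<Sum>i=1..n. \<eta> * h powr a) / w"
        unfolding eq abs_divide abs_of_pos[OF w] by (rule divide_right_mono) (use w in simp)
      also have "\<dots> = real n * h * \<eta>" using w by (simp add: ha)
      also have "\<dots> = \<epsilon> / 2" using assms(2) by (simp only: h(2)) (simp add: \<eta>_def)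
      also have "\<dots> < \<epsilon>" using \<open>0 < \<epsilon>\<close> by simp
      finally show ?case by (simp add: h_def w_def)
    qed
  qed
  from tendsto_add[OF this R] show ?thesis by simp
qed

text \<open>Meant for the cross-covariance of \<open>X\<close> and \<open>W\<close>:
  \<open>n\<close> cells of order \<open>h powr p\<close> add up to order
  \<open>h powr (p - 1)\<close>, which \<open>a < p\<close> makes smaller than
  \<open>h powr (a - 1)\<close>.\<close>

lemma sum_diagonal_rect_negligible:
  assumes "cell_bounded L p K" "0 < L" "a < p"
  shows "(\<lambda>n. (\<Sum>i=1..n. mesh_rect L K n i i) / (L / real n) powr (a - 1)) \<longlonglongrightarrow> 0"
proof -
  obtain C \<delta> where C: "0 \<le> C" "0 < \<delta>"
    "\<And>n i j. L / real n < \<delta> \<Longrightarrow> i \<in> {1..n} \<Longrightarrow> j \<in> {1..n} \<Longrightarrow> real (i - j + (j - i)) * (L / real n) < \<delta> \<Longrightarrow>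
       \<bar>mesh_rect L K n i j\<bar> \<le> C * ((L / real n) powr p * max 1 (real (i - j + (j - i))) powr (p - 2))"
    using cell_bounded_mesh[OF assms(1,2)] by metis
  have lim: "(\<lambda>n. C * L * (L / real n) powr (p - a)) \<longlonglongrightarrow> C * L * 0"
    using assms(2,3) by (intro tendsto_mult_left) real_asymp
  show ?thesis
  proof (rule Lim_null_comparison[OF _ lim[simplified]])
    have "eventually (\<lambda>n. L / real n < \<delta> \<and> 0 < n) sequentially"
      using order_tendstoD(2)[OF lim_const_over_n[of L] C(2)] eventually_gt_at_top[of 0] by eventually_elim simp
    then show "\<forall>\<^sub>F n in sequentially. norm ((\<Sum>i=1..n. mesh_rect L K n i i) / (L / real n) powr (a - 1)) \<le> C * L * (L / real n) powr (p - a)"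
    proof eventually_elim
      case (elim n)
      define h where "h = L / real n"
      have h: "0 < h" "real n * h = L" using elim assms(2) by (auto simp: h_def)
      have "\<bar>\<Sum>i=1..n. mesh_rect L K n i i\<bar> \<le> (\<Sum>i=1..n. C * h powr p)"
      proof (rule order_trans[OF sum_abs sum_mono])
        fix i assume "i \<in> {1..n}"
        then show "\<bar>mesh_rect L K n i i\<bar> \<le> C * h powr p"
          using C(3)[of n i i] elim C(2) by (simp add: h_def max_def)
      qed
      then have "\<bar>\<Sum>i=1..n. mesh_rect L K n i i\<bar> / h powr (a - 1) \<le> (\<Sum>i=1..n. C * h powr p) / h powr (a - 1)"
        by (intro divide_right_mono) auto
      also have "\<dots> = C * (real n * h) * h powr (p - a)"
        using h(1) by (simp add: powr_diff field_simps)
      finally show ?case by (simp add: h h_def[symmetric])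
    qed
  qed
qed

section \<open>Concentration of increment sums\<close>

context gaussian_linear_space
begin

lemma expectation_increment_product:
  assumes "\<And>s. s \<in> {0..L} \<Longrightarrow> A s \<in> H" "\<And>s. s \<in> {0..L} \<Longrightarrow> B s \<in> H"
    "\<And>s t. s \<in> {0..L} \<Longrightarrow> t \<in> {0..L} \<Longrightarrow> expectation (\<lambda>\<omega>. A s \<omega> * B t \<omega>) = K s t"
    "s \<in> {0..L}" "s' \<in> {0..L}" "t \<in> {0..L}" "t' \<in> {0..L}"
  shows "expectation (\<lambda>\<omega>. (A s' \<omega> - A s \<omega>) * (B t' \<omega> - B t \<omega>)) = rect_increment K s s' t t'"
proof -
  have "expectation (\<lambda>\<omega>. (A s' \<omega> - A s \<omega>) * (B t' \<omega> - B t \<omega>)) =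
      expectation (\<lambda>\<omega>. A s' \<omega> * B t' \<omega> - A s' \<omega> * B t \<omega> - A s \<omega> * B t' \<omega> + A s \<omega> * B t \<omega>)"
    by (simp add: algebra_simps)
  also have "\<dots> = rect_increment K s s' t t'"
    unfolding rect_increment_def using assms
    by (simp add: integrable_product)
  finally show ?thesis .
qed

text \<open>Serves the denominator with \<open>B = A\<close> and the numerator error with
  \<open>B = W\<close>. Both pairings have exponents with sum \<open>q\<close>, so every product at
  distance \<open>k\<close> is at most a multiple of \<open>h powr q * max 1 k powr (q - 4)\<close>.
  \<open>q < 3\<close> makes this summable over \<open>k\<close>, and \<open>n\<close> rows yield a
  variance of order \<open>h powr (q - 1)\<close>, small against \<open>h powr (2 * a - 2)\<close>
  by \<open>2 * a - 1 < q\<close>.\<close>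

lemma increment_product_concentration:
  assumes L: "0 < L"
    and H: "\<And>s. s \<in> {0..L} \<Longrightarrow> A s \<in> H" "\<And>s. s \<in> {0..L} \<Longrightarrow> B s \<in> H"
    and cov: "\<And>s t. s \<in> {0..L} \<Longrightarrow> t \<in> {0..L} \<Longrightarrow> expectation (\<lambda>\<omega>. A s \<omega> * A t \<omega>) = K\<^sub>1\<^sub>1 s t"
      "\<And>s t. s \<in> {0..L} \<Longrightarrow> t \<in> {0..L} \<Longrightarrow> expectation (\<lambda>\<omega>. B s \<omega> * B t \<omega>) = K\<^sub>2\<^sub>2 s t"
      "\<And>s t. s \<in> {0..L} \<Longrightarrow> t \<in> {0..L} \<Longrightarrow> expectation (\<lambda>\<omega>. A s \<omega> * B t \<omega>) = K\<^sub>1\<^sub>2 s t"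
    and K: "cell_bounded L p\<^sub>1 K\<^sub>1\<^sub>1" "cell_bounded L p\<^sub>2 K\<^sub>2\<^sub>2" "cell_bounded L (q / 2) K\<^sub>1\<^sub>2"
    and q: "p\<^sub>1 + p\<^sub>2 = q" "q < 3" "2 * a - 1 < q"
  defines "T \<equiv> \<lambda>n \<omega>. \<Sum>i=1..n. mesh_increment L A n i \<omega> * mesh_increment L B n i \<omega>"
  shows "expectation (T n) = (\<Sum>i=1..n. mesh_rect L K\<^sub>1\<^sub>2 n i i)"
    and "T n \<in> borel_measurable M"
    and "0 < \<eta> \<Longrightarrow> (\<lambda>n. prob {\<omega> \<in> space M. \<eta> * (L / real n) powr (a - 1) \<le> \<bar>T n \<omega> - expectation (T n)\<bar>}) \<longlonglongrightarrow> 0"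
proof -
  have inH: "mesh_increment L A n i \<in> H" "mesh_increment L B n i \<in> H" if "i \<in> {1..n}" for n i
    using mesh_point[OF L that] by (intro diff H; simp)+
  have prods: "expectation (\<lambda>\<omega>. mesh_increment L A n i \<omega> * mesh_increment L A n j \<omega>) = mesh_rect L K\<^sub>1\<^sub>1 n i j"
      "expectation (\<lambda>\<omega>. mesh_increment L B n i \<omega> * mesh_increment L B n j \<omega>) = mesh_rect L K\<^sub>2\<^sub>2 n i j"
      "expectation (\<lambda>\<omega>. mesh_increment L A n i \<omega> * mesh_increment L B n j \<omega>) = mesh_rect L K\<^sub>1\<^sub>2 n i j"
      "expectation (\<lambda>\<omega>. mesh_increment L B n i \<omega> * mesh_increment L A n j \<omega>) = mesh_rect L K\<^sub>1\<^sub>2 n j i"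
    if "i \<in> {1..n}" "j \<in> {1..n}" for n i j
  proof -
    note pt = mesh_point(1,2)[OF L that(1)] mesh_point(1,2)[OF L that(2)]
    show "expectation (\<lambda>\<omega>. mesh_increment L A n i \<omega> * mesh_increment L A n j \<omega>) = mesh_rect L K\<^sub>1\<^sub>1 n i j"
      by (rule expectation_increment_product[OF H(1) H(1) cov(1) pt])
    show "expectation (\<lambda>\<omega>. mesh_increment L B n i \<omega> * mesh_increment L B n j \<omega>) = mesh_rect L K\<^sub>2\<^sub>2 n i j"
      by (rule expectation_increment_product[OF H(2) H(2) cov(2) pt])
    show "expectation (\<lambda>\<omega>. mesh_increment L A n i \<omega> * mesh_increment L B n j \<omega>) = mesh_rect L K\<^sub>1\<^sub>2 n i j"
      by (rule expectation_increment_product[OF H(1) H(2) cov(3) pt])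
    \<comment> \<open>A cross-covariance need not be symmetric in its arguments, so exchanging the
      components exchanges \<open>i\<close> and \<open>j\<close>.\<close>
    show "expectation (\<lambda>\<omega>. mesh_increment L B n i \<omega> * mesh_increment L A n j \<omega>) = mesh_rect L K\<^sub>1\<^sub>2 n j i"
      using expectation_increment_product[OF H(1) H(2) cov(3) pt(3,4,1,2)] by (simp add: mult.commute)
  qed
  have eT: "expectation (T n) = (\<Sum>i=1..n. mesh_rect L K\<^sub>1\<^sub>2 n i i)" for n
  proof -
    have "expectation (T n) = (\<Sum>i=1..n. expectation (\<lambda>\<omega>. mesh_increment L A n i \<omega> * mesh_increment L B n i \<omega>))"
      unfolding T_def by (intro Bochner_Integration.integral_sum integrable_product inH)
    also have "\<dots> = (\<Sum>i=1..n. mesh_rect L K\<^sub>1\<^sub>2 n i i)" by (intro sum.cong refl prods(3))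
    finally show ?thesis .
  qed
  have iT: "integrable M (T n)" for n
    unfolding T_def by (intro Bochner_Integration.integrable_sum integrable_product inH)
  then have mT: "T n \<in> borel_measurable M" for n by (rule borel_measurable_integrable)
  show "expectation (T n) = (\<Sum>i=1..n. mesh_rect L K\<^sub>1\<^sub>2 n i i)" "T n \<in> borel_measurable M"
    by (rule eT mT)+
  obtain C1 \<delta>1 where C1: "0 \<le> C1" "0 < \<delta>1"
    "\<And>n i j. L / real n < \<delta>1 \<Longrightarrow> i \<in> {1..n} \<Longrightarrow> j \<in> {1..n} \<Longrightarrow> real (i - j + (j - i)) * (L / real n) < \<delta>1 \<Longrightarrow>
       \<bar>mesh_rect L K\<^sub>1\<^sub>1 n i j\<bar> \<le> C1 * ((L / real n) powr p\<^sub>1 * max 1 (real (i - j + (j - i))) powr (p\<^sub>1 - 2))"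
    using cell_bounded_mesh[OF K(1) L] by metis
  obtain C2 \<delta>2 where C2: "0 \<le> C2" "0 < \<delta>2"
    "\<And>n i j. L / real n < \<delta>2 \<Longrightarrow> i \<in> {1..n} \<Longrightarrow> j \<in> {1..n} \<Longrightarrow> real (i - j + (j - i)) * (L / real n) < \<delta>2 \<Longrightarrow>
       \<bar>mesh_rect L K\<^sub>2\<^sub>2 n i j\<bar> \<le> C2 * ((L / real n) powr p\<^sub>2 * max 1 (real (i - j + (j - i))) powr (p\<^sub>2 - 2))"
    using cell_bounded_mesh[OF K(2) L] by metis
  obtain C3 \<delta>3 where C3: "0 \<le> C3" "0 < \<delta>3"
    "\<And>n i j. L / real n < \<delta>3 \<Longrightarrow> i \<in> {1..n} \<Longrightarrow> j \<in> {1..n} \<Longrightarrow> real (i - j + (j - i)) * (L / real n) < \<delta>3 \<Longrightarrow>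
       \<bar>mesh_rect L K\<^sub>1\<^sub>2 n i j\<bar> \<le> C3 * ((L / real n) powr (q / 2) * max 1 (real (i - j + (j - i))) powr (q / 2 - 2))"
    using cell_bounded_mesh[OF K(3) L] by metis
  define \<delta> where "\<delta> = min \<delta>1 (min \<delta>2 \<delta>3)"
  have \<delta>: "0 < \<delta>" using C1(2) C2(2) C3(2) by (simp add: \<delta>_def)
  \<comment> \<open>Increments in one of \<open>m\<close> blocks are at most \<open>L / m\<close>
    apart, which is below \<open>\<delta>\<close>. This \<open>m\<close> does not depend on
    \<open>n\<close>.\<close>
  obtain m :: nat where m: "L / \<delta> < real m" using reals_Archimedean2 by blast
  then have "0 < real m" using L \<delta> by (meson divide_pos_pos less_trans)
  define f :: "nat \<Rightarrow> real" where "f k = max 1 (real k) powr (q - 4)" for k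
  have "summable f"
  proof (rule summable_comparison_test_ev[OF _ summable_real_powr_iff[THEN iffD2]])
    show "\<forall>\<^sub>F k in sequentially. norm (f k) \<le> real k powr (q - 4)"
      using eventually_ge_at_top[of 1] by eventually_elim (simp add: f_def max_def)
  qed (use q in auto)
  \<comment> \<open>\<open>m\<close> is the price of the blocks, \<open>C1 * C2\<close> and
    \<open>C3 * C3\<close> belong to the two pairings, \<open>2 * suminf f\<close> bounds a row and
    \<open>L\<close> is \<open>n * h\<close>.\<close>
  define D where "D = real m * ((C1 * C2 + C3 * C3) * (2 * suminf f * L))"
  have var: "variance (T n) \<le> D * (L / real n) powr (q - 1)"
      and iT2: "integrable M (\<lambda>\<omega>. (T n \<omega> - expectation (T n))\<^sup>2)" if n: "L / real n < \<delta>" "0 < n" for n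
  proof -
    define h where "h = L / real n"
    have h: "0 < h" "real n * h = L" using n L by (auto simp: h_def)
    \<comment> \<open>Dividing by \<open>n + 1\<close> rather than \<open>n\<close> keeps the last
      index \<open>i = n\<close> in a block below \<open>m\<close>.\<close>
    define g where "g i = i * m div (n + 1)" for i
    have "i * m div (n + 1) < m" if "i \<in> {1..n}" for i
    proof -
      have "i * m < m * (n + 1)" using that \<open>0 < real m\<close> by (simp add: mult.commute[of m] mult_less_mono1 del: mult_Suc mult_Suc_right)
      then show ?thesis by (simp add: div_less_iff_less_mult)
    qed
    then have g: "g ` {1..n} \<subseteq> {..<m}" by (auto simp: g_def)
    show "integrable M (\<lambda>\<omega>. (T n \<omega> - expectation (T n))\<^sup>2)"
      unfolding T_def by (rule blockwise_variance_bound(1)[OF _ _ _ g]) (use inH in auto)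
    have "variance (T n) \<le> real m * (\<Sum>i=1..n. \<Sum>j\<in>{j \<in> {1..n}. g j = g i}.
        \<bar>expectation (\<lambda>\<omega>. mesh_increment L A n i \<omega> * mesh_increment L A n j \<omega>)\<bar> *
        \<bar>expectation (\<lambda>\<omega>. mesh_increment L B n i \<omega> * mesh_increment L B n j \<omega>)\<bar> +
        \<bar>expectation (\<lambda>\<omega>. mesh_increment L A n i \<omega> * mesh_increment L B n j \<omega>)\<bar> *
        \<bar>expectation (\<lambda>\<omega>. mesh_increment L B n i \<omega> * mesh_increment L A n j \<omega>)\<bar>)"
      unfolding T_def by (rule blockwise_variance_bound(2)) (use inH g in auto)
    also have "\<dots> \<le> real m * (\<Sum>i=1..n. \<Sum>j\<in>{j \<in> {1..n}. g j = g i}. (C1 * C2 + C3 * C3) * h powr q * f (i - j + (j - i)))"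
    proof (intro mult_left_mono sum_mono)
      fix i j assume i: "i \<in> {1..n}" and j': "j \<in> {j \<in> {1..n}. g j = g i}"
      then have j: "j \<in> {1..n}" and "g i = g j" by auto
      then have "(i - j + (j - i)) * m \<le> n" unfolding g_def by (intro same_block_close)
      then have "real (i - j + (j - i)) * real m \<le> real n" by (simp flip: of_nat_mult of_nat_add)
      then have "real (i - j + (j - i)) * real m * h \<le> real n * h" using h(1) by (intro mult_right_mono) auto
      then have "real (i - j + (j - i)) * h \<le> L / real m"
        unfolding pos_le_divide_eq[OF \<open>0 < real m\<close>] h(2) by (simp only: mult_ac)
      also have "\<dots> < \<delta>" using m \<delta> \<open>0 < real m\<close> by (simp add: field_simps)
      finally have d: "real (i - j + (j - i)) * h < \<delta>" .
      have dji: "j - i + (i - j) = i - j + (j - i)" by simp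
      let ?k = "max 1 (real (i - j + (j - i)))"
      have hd: "h < \<delta>1" "h < \<delta>2" "h < \<delta>3" "real (i - j + (j - i)) * h < \<delta>1"
          "real (i - j + (j - i)) * h < \<delta>2" "real (i - j + (j - i)) * h < \<delta>3"
        using n(1) d by (simp_all only: \<delta>_def h_def min_less_iff_conj)
      have b: "\<bar>mesh_rect L K\<^sub>1\<^sub>1 n i j\<bar> \<le> C1 * (h powr p\<^sub>1 * ?k powr (p\<^sub>1 - 2))"
          "\<bar>mesh_rect L K\<^sub>2\<^sub>2 n i j\<bar> \<le> C2 * (h powr p\<^sub>2 * ?k powr (p\<^sub>2 - 2))"
          "\<bar>mesh_rect L K\<^sub>1\<^sub>2 n i j\<bar> \<le> C3 * (h powr (q / 2) * ?k powr (q / 2 - 2))"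
          "\<bar>mesh_rect L K\<^sub>1\<^sub>2 n j i\<bar> \<le> C3 * (h powr (q / 2) * ?k powr (q / 2 - 2))"
        using C1(3)[of n i j] C2(3)[of n i j] C3(3)[of n i j] C3(3)[of n j i] i j hd
        unfolding h_def[symmetric] dji by blast+
      have "\<bar>mesh_rect L K\<^sub>1\<^sub>1 n i j\<bar> * \<bar>mesh_rect L K\<^sub>2\<^sub>2 n i j\<bar> \<le>
          (C1 * (h powr p\<^sub>1 * ?k powr (p\<^sub>1 - 2))) * (C2 * (h powr p\<^sub>2 * ?k powr (p\<^sub>2 - 2)))"
        using C1(1) by (intro mult_mono b) auto
      also have "\<dots> = C1 * C2 * h powr (p\<^sub>1 + p\<^sub>2) * ?k powr ((p\<^sub>1 - 2) + (p\<^sub>2 - 2))"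
        unfolding powr_add by simp
      also have "\<dots> = C1 * C2 * h powr q * f (i - j + (j - i))"
        using q(1) by (simp add: f_def algebra_simps flip: q(1))
      finally have 1: "\<bar>mesh_rect L K\<^sub>1\<^sub>1 n i j\<bar> * \<bar>mesh_rect L K\<^sub>2\<^sub>2 n i j\<bar> \<le> C1 * C2 * h powr q * f (i - j + (j - i))" .
      have "\<bar>mesh_rect L K\<^sub>1\<^sub>2 n i j\<bar> * \<bar>mesh_rect L K\<^sub>1\<^sub>2 n j i\<bar> \<le>
          (C3 * (h powr (q / 2) * ?k powr (q / 2 - 2))) * (C3 * (h powr (q / 2) * ?k powr (q / 2 - 2)))"
        using C3(1) by (intro mult_mono b) auto
      also have "\<dots> = C3 * C3 * h powr (q / 2 + q / 2) * ?k powr ((q / 2 - 2) + (q / 2 - 2))"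
        unfolding powr_add by simp
      also have "\<dots> = C3 * C3 * h powr q * f (i - j + (j - i))"
        by (simp add: f_def)
      finally have 2: "\<bar>mesh_rect L K\<^sub>1\<^sub>2 n i j\<bar> * \<bar>mesh_rect L K\<^sub>1\<^sub>2 n j i\<bar> \<le> C3 * C3 * h powr q * f (i - j + (j - i))" .
      show "\<bar>expectation (\<lambda>\<omega>. mesh_increment L A n i \<omega> * mesh_increment L A n j \<omega>)\<bar> *
        \<bar>expectation (\<lambda>\<omega>. mesh_increment L B n i \<omega> * mesh_increment L B n j \<omega>)\<bar> +
        \<bar>expectation (\<lambda>\<omega>. mesh_increment L A n i \<omega> * mesh_increment L B n j \<omega>)\<bar> *
        \<bar>expectation (\<lambda>\<omega>. mesh_increment L B n i \<omega> * mesh_increment L A n j \<omega>)\<bar>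
        \<le> (C1 * C2 + C3 * C3) * h powr q * f (i - j + (j - i))"
        unfolding prods[OF i j] using 1 2 by (simp add: distrib_right)
    qed simp
    \<comment> \<open>The restriction to one block has served to justify the bounds near the
      diagonal. The bounding terms are nonnegative, so the inner sum may now run over all
      \<open>j\<close>.\<close>
    also have "\<dots> \<le> real m * (\<Sum>i=1..n. \<Sum>j=1..n. (C1 * C2 + C3 * C3) * h powr q * f (i - j + (j - i)))"
      using C1(1) C2(1) by (intro mult_left_mono sum_mono sum_mono2) (auto simp: f_def)
    also have "\<dots> = real m * ((C1 * C2 + C3 * C3) * h powr q * (\<Sum>i=1..n. \<Sum>j=1..n. f (i - j + (j - i))))"
      by (simp add: sum_distrib_left)
    also have "\<dots> \<le> real m * ((C1 * C2 + C3 * C3) * h powr q * (2 * suminf f * real n))"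
      using C1(1) C2(1) toeplitz_sum_bound[OF \<open>summable f\<close>, of n] by (intro mult_left_mono) (auto simp: f_def)
    also have "\<dots> = D * h powr (q - 1)"
      using h(1) by (simp add: D_def h(2)[symmetric] powr_diff field_simps)
    finally show "variance (T n) \<le> D * (L / real n) powr (q - 1)" by (simp add: h_def)
  qed
  have "(\<lambda>n. (L / real n) powr (q + 1 - 2 * a)) \<longlonglongrightarrow> 0"
    using L q(3) by real_asymp
  from tendsto_mult_left[OF this, of "D / \<eta>\<^sup>2"]
  have lim: "(\<lambda>n. D / \<eta>\<^sup>2 * (L / real n) powr (q + 1 - 2 * a)) \<longlonglongrightarrow> 0" by (simp only: mult_zero_right)
  show "(\<lambda>n. prob {\<omega> \<in> space M. \<eta> * (L / real n) powr (a - 1) \<le> \<bar>T n \<omega> - expectation (T n)\<bar>}) \<longlonglongrightarrow> 0"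
    if "0 < \<eta>"
  proof (rule Lim_null_comparison[OF _ lim])
    have "eventually (\<lambda>n. L / real n < \<delta> \<and> 0 < n) sequentially"
      using order_tendstoD(2)[OF lim_const_over_n[of L] \<delta>] eventually_gt_at_top[of 0] by eventually_elim simp
    then show "\<forall>\<^sub>F n in sequentially. norm (prob {\<omega> \<in> space M. \<eta> * (L / real n) powr (a - 1) \<le> \<bar>T n \<omega> - expectation (T n)\<bar>})
        \<le> D / \<eta>\<^sup>2 * (L / real n) powr (q + 1 - 2 * a)"
    proof (rule eventually_mono)
      fix n assume elim: "L / real n < \<delta> \<and> 0 < n"
      define h where "h = L / real n"
      have h: "0 < h" using elim L by (auto simp: h_def)
      define e where "e = expectation (T n)"
      \<comment> \<open>The square integrability of \<open>T n\<close>, which Chebyshev's inequality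
        asks for, is recovered from that of the centred sum.\<close>
      have "integrable M (\<lambda>\<omega>. (T n \<omega> - e)\<^sup>2 + 2 * e * T n \<omega> - e\<^sup>2)"
        using iT2[of n] elim iT[of n] by (simp add: e_def)
      also have "(\<lambda>\<omega>. (T n \<omega> - e)\<^sup>2 + 2 * e * T n \<omega> - e\<^sup>2) = (\<lambda>\<omega>. (T n \<omega>)\<^sup>2)"
        by (simp add: fun_eq_iff power2_eq_square algebra_simps)
      finally have "prob {\<omega> \<in> space M. \<eta> * h powr (a - 1) \<le> \<bar>T n \<omega> - expectation (T n)\<bar>}
          \<le> variance (T n) / (\<eta> * h powr (a - 1))\<^sup>2"
        using \<open>0 < \<eta>\<close> h by (intro Chebyshev_inequality mT) auto
      also have "\<dots> \<le> D * h powr (q - 1) / (\<eta> * h powr (a - 1))\<^sup>2"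
        using var[of n] elim by (intro divide_right_mono) (auto simp: h_def)
      also have "\<dots> = D / \<eta>\<^sup>2 * (h powr (q - 1) / (h powr (a - 1))\<^sup>2)"
        by (simp add: power_mult_distrib)
      also have "h powr (q - 1) / (h powr (a - 1))\<^sup>2 = h powr (q + 1 - 2 * a)"
        using h by (simp add: power2_eq_square flip: powr_add powr_diff) (simp add: algebra_simps)
      finally show "norm (prob {\<omega> \<in> space M. \<eta> * (L / real n) powr (a - 1) \<le> \<bar>T n \<omega> - expectation (T n)\<bar>})
        \<le> D / \<eta>\<^sup>2 * (L / real n) powr (q + 1 - 2 * a)" by (simp add: h_def)
    qed
  qed
qed

end

section \<open>Consistency\<close>

text \<open>The deterministic part: \<open>m\<close> and \<open>e\<close> are the means of
  \<open>S\<close> and \<open>N\<close>, and \<open>w\<close> is their common scale. A mean above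
  \<open>c / 2 * w\<close> and a deviation below \<open>c / 4 * w\<close> leave
  \<open>S > c / 4 * w\<close>, while mean and deviation of \<open>N\<close>, each below
  \<open>\<epsilon> * c / 8 * w\<close>, give
  \<open>\<bar>N\<bar> < \<epsilon> * (c / 4 * w)\<close>.\<close>

lemma ratio_error_bound:
  fixes S N m e w c \<epsilon> :: real
  assumes "0 < w" "0 < c" "0 < \<epsilon>" "c / 2 < m / w" "\<bar>e / w\<bar> < \<epsilon> * c / 8"
    "\<bar>S - m\<bar> < c / 4 * w" "\<bar>N - e\<bar> < \<epsilon> * c / 8 * w"
  shows "0 < S" "\<bar>N / S\<bar> < \<epsilon>"
proof -
  have "c / 2 * w < m" using assms(1,4) by (simp add: pos_less_divide_eq)
  with assms(6) have S: "c / 4 * w < S" by linarith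
  moreover have "0 < c / 4 * w" using assms(1,2) by simp
  ultimately show pos: "0 < S" by linarith
  have "\<bar>e\<bar> < \<epsilon> * c / 8 * w" using assms(1,5) by (simp add: abs_divide pos_divide_less_eq)
  moreover have "\<epsilon> * (c / 4 * w) = 2 * (\<epsilon> * c / 8 * w)" by simp
  ultimately have "\<bar>N\<bar> < \<epsilon> * (c / 4 * w)" using assms(7) by linarith
  also have "\<dots> < \<epsilon> * S" using S assms(3) by (rule mult_strict_left_mono)
  finally show "\<bar>N / S\<bar> < \<epsilon>" using pos by (simp add: abs_divide pos_divide_less_eq)
qed

theorem theorem7:
  fixes M :: "'a measure"
    and X W Y :: "real \<Rightarrow> 'a \<Rightarrow> real"
    and K :: "nat \<Rightarrow> nat \<Rightarrow> real \<Rightarrow> real \<Rightarrow> real"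
    and \<alpha> :: "nat \<Rightarrow> nat \<Rightarrow> real"
    and \<Gamma>\<^sub>0 \<Gamma>\<^sub>2 \<Gamma>\<^sub>\<alpha> r :: "real \<Rightarrow> real \<Rightarrow> real"
    and L \<beta> :: real
  assumes "0 < L"
    and "zero_mean_gaussian_field M {1, 2} {0..L} (\<lambda>k. if k = 1 then X else W) K"
    and "\<forall>k\<in>{1, 2}. \<forall>l\<in>{1, 2}. in_class_K L (\<alpha> k l) (K k l)"
    and "\<forall>s\<in>{0..L}. \<forall>\<omega>\<in>space M. Y s \<omega> = X s \<omega> * \<beta> + W s \<omega>"
    and "has_expansion L (\<alpha> 1 1) (K 1 1) \<Gamma>\<^sub>0 \<Gamma>\<^sub>2 \<Gamma>\<^sub>\<alpha> r"
    and "integral {0..L} (\<lambda>s. \<Gamma>\<^sub>\<alpha> s s) \<noteq> 0"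
    and "\<alpha> 1 1 < Min {\<alpha> 1 2, \<alpha> 2 2 + 1, 2}"
  shows "converges_in_probability M
           (\<lambda>n \<omega>. ols_first_differences L n (\<lambda>s. X s \<omega>) (\<lambda>s. Y s \<omega>)) \<beta>"
proof -
  let ?Z = "\<lambda>k::nat. if k = 1 then X else W"
  define H where "H = finite_combinations {1, 2} {0..L} ?Z"
  interpret gaussian_linear_space M H
    unfolding H_def by (rule zero_mean_gaussian_field_linear_space[OF assms(2)])
  have XH: "X s \<in> H" and WH: "W s \<in> H" if "s \<in> {0..L}" for s
    using finite_combinations_base[of "1::nat" "{1, 2}" s "{0..L}" ?Z]
      finite_combinations_base[of "2::nat" "{1, 2}" s "{0..L}" ?Z] that by (simp_all add: H_def)
  have covZ: "expectation (\<lambda>\<omega>. ?Z k s \<omega> * ?Z l t \<omega>) = K k l s t"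
    if "k \<in> {1, 2}" "l \<in> {1, 2}" "s \<in> {0..L}" "t \<in> {0..L}" for k l s t
    using assms(2) that unfolding zero_mean_gaussian_field_def by blast
  have cov: "expectation (\<lambda>\<omega>. X s \<omega> * X t \<omega>) = K 1 1 s t" "expectation (\<lambda>\<omega>. W s \<omega> * W t \<omega>) = K 2 2 s t"
      "expectation (\<lambda>\<omega>. X s \<omega> * W t \<omega>) = K 1 2 s t" if "s \<in> {0..L}" "t \<in> {0..L}" for s t
    using covZ[of 1 1 s t] covZ[of 2 2 s t] covZ[of 1 2 s t] that by simp_all
  define a where "a = \<alpha> 1 1"
  have a: "a < \<alpha> 1 2" "a < \<alpha> 2 2 + 1" "a < 2" using assms(7) by (auto simp: a_def)
  have cb: "cell_bounded L p (K 1 1)" if "p \<le> a" for p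
    using cell_bounded_mono[OF cell_bounded_class[of L "\<alpha> 1 1" "K 1 1"], of p] assms(1,3) that a by (simp add: a_def)
  have cb22: "cell_bounded L p (K 2 2)" if "p \<le> min (\<alpha> 2 2) 2" for p
    using cell_bounded_mono[OF cell_bounded_class[of L "\<alpha> 2 2" "K 2 2"], of p] assms(1,3) that by simp
  have cb12: "cell_bounded L p (K 1 2)" if "p \<le> min (\<alpha> 1 2) 2" for p
    using cell_bounded_mono[OF cell_bounded_class[of L "\<alpha> 1 2" "K 1 2"], of p] assms(1,3) that by simp
  \<comment> \<open>The bound 3 on \<open>q\<close> is for summability, \<open>2 * a\<close> makes
    \<open>q / 2\<close> admissible for \<open>K 1 1\<close> and \<open>K 1 2\<close>, and the last
    makes \<open>q - a\<close> admissible for \<open>K 2 2\<close>. Room above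
    \<open>2 * a - 1\<close> is left by \<open>a < 2\<close> and
    \<open>a < \<alpha> 2 2 + 1\<close>.\<close>
  have "2 * a - 1 < min 3 (min (2 * a) (a + min (\<alpha> 2 2) 2))" using a by auto
  then obtain q where "2 * a - 1 < q" "q < min 3 (min (2 * a) (a + min (\<alpha> 2 2) 2))"
    using dense by blast
  then have q: "2 * a - 1 < q" "q < 3" "q < 2 * a" "q < a + min (\<alpha> 2 2) 2" by simp_all
  \<comment> \<open>\<open>S\<close> uses the exponent \<open>q / 2\<close> throughout;
    \<open>N\<close> pairs the full exponent \<open>a\<close> of \<open>X\<close> with
    \<open>q - a\<close> for \<open>W\<close>.\<close>
  have q': "q / 2 + q / 2 = q" "a + (q - a) = q" by simp_all
  define S where "S n \<omega> = (\<Sum>i=1..n. mesh_increment L X n i \<omega> * mesh_increment L X n i \<omega>)" for n \<omega>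
  define N where "N n \<omega> = (\<Sum>i=1..n. mesh_increment L X n i \<omega> * mesh_increment L W n i \<omega>)" for n \<omega>
  have b: "cell_bounded L (q / 2) (K 1 1)" "cell_bounded L (q - a) (K 2 2)" "cell_bounded L (q / 2) (K 1 2)"
    using cb[of "q / 2"] cb22[of "q - a"] cb12[of "q / 2"] q a by simp_all
  note SS = increment_product_concentration[where a = a, OF assms(1) XH XH cov(1) cov(1) cov(1) b(1,1,1) q'(1) q(2,1), folded S_def]
  note NN = increment_product_concentration[where a = a, OF assms(1) XH WH cov(1) cov(2) cov(3) cb[OF order_refl] b(2,3) q'(2) q(2,1), folded N_def]
  define w where "w n = (L / real n) powr (a - 1)" for n
  define c where "c = - 2 * integral {0..L} (\<lambda>s. \<Gamma>\<^sub>\<alpha> s s)"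
  have mS: "(\<lambda>n. expectation (S n) / w n) \<longlonglongrightarrow> c"
    using sum_diagonal_rect_asymptotics[OF assms(5)[folded a_def] assms(1) a(3)]
    by (simp only: SS(1) w_def c_def)
  \<comment> \<open>Because of \<open>a < \<alpha> 1 2\<close> and \<open>a < 2\<close>, the
    exponent \<open>min (\<alpha> 1 2) 2\<close> of \<open>K 1 2\<close> exceeds
    \<open>a\<close>.\<close>
  have mN: "(\<lambda>n. expectation (N n) / w n) \<longlonglongrightarrow> 0"
    using sum_diagonal_rect_negligible[OF cb12[OF order_refl] assms(1), of a] a
    by (simp only: NN(1) w_def min_less_iff_conj)
  have "0 \<le> expectation (S n) / w n" for n
    by (intro divide_nonneg_nonneg integral_nonneg_AE) (auto simp: S_def w_def intro!: sum_nonneg)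
  then have "0 \<le> c" using mS by (intro LIMSEQ_le_const[OF mS]) auto
  with assms(6) have c: "0 < c" by (simp add: c_def)
  show ?thesis
    unfolding converges_in_probability_def
  proof (intro allI impI)
    fix \<epsilon> :: real assume \<epsilon>: "0 < \<epsilon>"
    let ?E = "\<lambda>n. {\<omega> \<in> space M. c / 4 * w n \<le> \<bar>S n \<omega> - expectation (S n)\<bar>}"
    let ?F = "\<lambda>n. {\<omega> \<in> space M. \<epsilon> * c / 8 * w n \<le> \<bar>N n \<omega> - expectation (N n)\<bar>}"
    have "(\<lambda>n. prob (?E n)) \<longlonglongrightarrow> 0" "(\<lambda>n. prob (?F n)) \<longlonglongrightarrow> 0"
      using SS(3)[where \<eta> = "c / 4"] NN(3)[where \<eta> = "\<epsilon> * c / 8"] c \<epsilon> unfolding w_def by simp_all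
    from tendsto_add[OF this] have lim: "(\<lambda>n. prob (?E n) + prob (?F n)) \<longlonglongrightarrow> 0" by simp
    \<comment> \<open>\<open>0 < n\<close> is included because \<open>L / 0 = 0\<close> makes
      \<open>w 0\<close> vanish.\<close>
    have ev: "\<forall>\<^sub>F n in sequentially. c / 2 < expectation (S n) / w n \<and> \<bar>expectation (N n) / w n\<bar> < \<epsilon> * c / 8 \<and> 0 < n"
      by (intro eventually_conj order_tendstoD(1)[OF mS] order_tendstoD(2)[OF tendsto_rabs_zero[OF mN]] eventually_gt_at_top)
        (use c \<epsilon> in simp_all)
    show "(\<lambda>n. prob {\<omega> \<in> space M. \<epsilon> < \<bar>ols_first_differences L n (\<lambda>s. X s \<omega>) (\<lambda>s. Y s \<omega>) - \<beta>\<bar>}) \<longlonglongrightarrow> 0"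
    proof (rule Lim_null_comparison[OF _ lim], rule eventually_mono[OF ev])
      fix n assume n: "c / 2 < expectation (S n) / w n \<and> \<bar>expectation (N n) / w n\<bar> < \<epsilon> * c / 8 \<and> 0 < n"
      have [measurable]: "S n \<in> borel_measurable M" "N n \<in> borel_measurable M" using SS(2) NN(2) by simp_all
      have w: "0 < w n" using n assms(1) by (simp add: w_def)
      have "{\<omega> \<in> space M. \<epsilon> < \<bar>ols_first_differences L n (\<lambda>s. X s \<omega>) (\<lambda>s. Y s \<omega>) - \<beta>\<bar>} \<subseteq> ?E n \<union> ?F n"
      proof
        fix \<omega> assume "\<omega> \<in> {\<omega> \<in> space M. \<epsilon> < \<bar>ols_first_differences L n (\<lambda>s. X s \<omega>) (\<lambda>s. Y s \<omega>) - \<beta>\<bar>}"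
        then have \<omega>: "\<omega> \<in> space M" "\<epsilon> < \<bar>ols_first_differences L n (\<lambda>s. X s \<omega>) (\<lambda>s. Y s \<omega>) - \<beta>\<bar>" by auto
        show "\<omega> \<in> ?E n \<union> ?F n"
        proof (rule ccontr)
          assume "\<omega> \<notin> ?E n \<union> ?F n"
          then have "\<bar>S n \<omega> - expectation (S n)\<bar> < c / 4 * w n" "\<bar>N n \<omega> - expectation (N n)\<bar> < \<epsilon> * c / 8 * w n"
            using \<omega>(1) by auto
          note r = ratio_error_bound[OF w c \<epsilon> _ _ this]
          have "mesh_increment L X n i \<omega> * mesh_increment L Y n i \<omega> =
              \<beta> * (mesh_increment L X n i \<omega> * mesh_increment L X n i \<omega>) + mesh_increment L X n i \<omega> * mesh_increment L W n i \<omega>"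
            if "i \<in> {1..n}" for i
          proof -
            have "mesh_increment L Y n i \<omega> = \<beta> * mesh_increment L X n i \<omega> + mesh_increment L W n i \<omega>"
              using assms(4) \<omega>(1) mesh_point(1,2)[OF assms(1) that] by (simp add: right_diff_distrib mult.commute)
            then show ?thesis by (simp only: distrib_left mult.left_commute)
          qed
          then have "(\<Sum>i=1..n. mesh_increment L X n i \<omega> * mesh_increment L Y n i \<omega>) = \<beta> * S n \<omega> + N n \<omega>"
            unfolding S_def N_def sum_distrib_left sum.distrib[symmetric] by (intro sum.cong refl)
          then have "ols_first_differences L n (\<lambda>s. X s \<omega>) (\<lambda>s. Y s \<omega>) = (\<beta> * S n \<omega> + N n \<omega>) / S n \<omega>"
            by (simp add: ols_first_differences_def Let_def S_def power2_eq_square)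
          \<comment> \<open>Here \<open>S n \<omega>\<close> is positive, so the quotient is genuine
            and not the default value of division by 0.\<close>
          also have "\<dots> = \<beta> + N n \<omega> / S n \<omega>" using r(1) n by (simp add: add_divide_distrib)
          finally show False using \<omega>(2) r(2) n by simp
        qed
      qed
      then have "prob {\<omega> \<in> space M. \<epsilon> < \<bar>ols_first_differences L n (\<lambda>s. X s \<omega>) (\<lambda>s. Y s \<omega>) - \<beta>\<bar>} \<le> prob (?E n \<union> ?F n)"
        by (rule finite_measure_mono) measurable
      also have "\<dots> \<le> prob (?E n) + prob (?F n)"
        by (rule measure_Un_le) measurable
      finally show "norm (prob {\<omega> \<in> space M. \<epsilon> < \<bar>ols_first_differences L n (\<lambda>s. X s \<omega>) (\<lambda>s. Y s \<omega>) - \<beta>\<bar>})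
          \<le> prob (?E n) + prob (?F n)" by simp
    qed
  qed
qed

end
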